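(* The set of chromatic zeros of all series-parallel graphs, that is, the set $\{q\in\mathbb{C} : Z(G;q)=0 \text{ for some series-parallel graph } G\}$, is dense in the set $\{q\in\mathbb{C} : \Re(q)>3/2\}$.
   Context: The chromatic polynomial of a finite graph $G=(V,E)$ (multiple edges allowed) is $Z(G;q)=\sum_{F\subseteq E}(-1)^{|F|}q^{k(F)}$, where $k(F)$ is the number of connected components of the graph $(V,F)$. A two-terminal graph is a graph with a designated start vertex $s$ and a designated end vertex $t$. Let $G_1,G_2$ be two-terminal graphs with terminals $s_1,t_1$ and $s_2,t_2$. Their parallel composition $G_1\parallel G_2$ is obtained from the disjoint union by identifying $s_1$ with $s_2$ into a single vertex $s$ and $t_1$ with $t_2$ into a single vertex $t$, with terminals $s,t$. Their series composition $G_1\bowtie G_2$ is obtained from the disjoint union by identifying $t_1$ with $s_2$, with start vertex $s=s_1$ and end vertex $t=t_2$. A two-terminal graph is series-parallel if it can be obtained from a single edge $K_2$ (whose two endpoints are the terminals) using series and parallel compositions. *)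

theory Defs
  imports "HOL-Analysis.Analysis" "HOL-Library.Uprod"
begin

text \<open>Multigraphs have named edges; each edge carries an unordered pair of endpoints (a loop
  carries \<open>Upair v v\<close>). The values of \<open>ends\<close> outside \<open>edges\<close> are irrelevant.\<close>

record ('v, 'e) multigraph =
  verts :: "'v set"
  edges :: "'e set"
  ends :: "'e \<Rightarrow> 'v uprod"

record ('v, 'e) tt_graph = "('v, 'e) multigraph" +
  start_vertex :: 'v
  end_vertex :: 'v

definition finite_multigraph :: "('v, 'e, 'z) multigraph_scheme \<Rightarrow> bool" where
  "finite_multigraph G \<longleftrightarrow>
     finite (verts G) \<and> finite (edges G) \<and> (\<forall>e\<in>edges G. set_uprod (ends G e) \<subseteq> verts G)"

definition adjacent_via :: "('v, 'e, 'z) multigraph_scheme \<Rightarrow> 'e set \<Rightarrow> 'v rel" where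
  "adjacent_via G F = {(u, v). \<exists>e\<in>F. ends G e = Upair u v}"

text \<open>Number of connected components of the spanning subgraph \<open>(verts G, F)\<close>. The relation
  \<open>adjacent_via G F\<close> is symmetric, so its reflexive-transitive closure is an equivalence.\<close>

definition num_components :: "('v, 'e, 'z) multigraph_scheme \<Rightarrow> 'e set \<Rightarrow> nat" where
  "num_components G F = card (verts G // (adjacent_via G F)\<^sup>*)"

definition chromatic_polynomial ::
    "('v, 'e, 'z) multigraph_scheme \<Rightarrow> 'a::comm_ring_1 \<Rightarrow> 'a" where
  "chromatic_polynomial G q = (\<Sum>F\<in>Pow (edges G). (- 1) ^ card F * q ^ num_components G F)"

definition tt_isomorphic :: "('v, 'e) tt_graph \<Rightarrow> ('w, 'f) tt_graph \<Rightarrow> bool" where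
  "tt_isomorphic G H \<longleftrightarrow>
     (\<exists>f g. bij_betw f (verts G) (verts H) \<and> bij_betw g (edges G) (edges H) \<and>
        (\<forall>e\<in>edges G. ends H (g e) = map_uprod f (ends G e)) \<and>
        f (start_vertex G) = start_vertex H \<and> f (end_vertex G) = end_vertex H)"

definition disjoint_union ::
    "('v, 'e, 'y) multigraph_scheme \<Rightarrow> ('w, 'f, 'z) multigraph_scheme
      \<Rightarrow> ('v + 'w, 'e + 'f) multigraph" where
  "disjoint_union G H =
     \<lparr>verts = verts G <+> verts H,
      edges = edges G <+> edges H,
      ends = case_sum (\<lambda>e. map_uprod Inl (ends G e)) (\<lambda>e. map_uprod Inr (ends H e))\<rparr>"

text \<open>Identifying the vertices related by \<open>R\<close>: a vertex of the resulting graph is a class of the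
  equivalence relation generated by \<open>R\<close>.\<close>

definition glued_vertex :: "'v rel \<Rightarrow> 'v \<Rightarrow> 'v set" where
  "glued_vertex R v = (R \<union> R\<inverse>)\<^sup>* `` {v}"

definition parallel ::
    "('v, 'e) tt_graph \<Rightarrow> ('w, 'f) tt_graph \<Rightarrow> (('v + 'w) set, 'e + 'f) tt_graph" where
  "parallel G H =
     (let D = disjoint_union G H;
          c = glued_vertex {(Inl (start_vertex G), Inr (start_vertex H)),
                            (Inl (end_vertex G), Inr (end_vertex H))}
      in \<lparr>verts = c ` verts D,
          edges = edges D,
          ends = (\<lambda>e. map_uprod c (ends D e)),
          start_vertex = c (Inl (start_vertex G)),
          end_vertex = c (Inl (end_vertex G))\<rparr>)"

definition series ::
    "('v, 'e) tt_graph \<Rightarrow> ('w, 'f) tt_graph \<Rightarrow> (('v + 'w) set, 'e + 'f) tt_graph" where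
  "series G H =
     (let D = disjoint_union G H;
          c = glued_vertex {(Inl (end_vertex G), Inr (start_vertex H))}
      in \<lparr>verts = c ` verts D,
          edges = edges D,
          ends = (\<lambda>e. map_uprod c (ends D e)),
          start_vertex = c (Inl (start_vertex G)),
          end_vertex = c (Inr (end_vertex H))\<rparr>)"

definition K2 :: "(bool, unit) tt_graph" where
  "K2 = \<lparr>verts = {False, True}, edges = {()}, ends = (\<lambda>_. Upair False True),
         start_vertex = False, end_vertex = True\<rparr>"

text \<open>Compositions change the vertex and edge types, so every rule produces an arbitrary isomorphic
  copy over the fixed types \<open>'v\<close> and \<open>'e\<close>. These must be infinite for all series-parallel graphs
  to be represented.\<close>

inductive series_parallel :: "('v, 'e) tt_graph \<Rightarrow> bool" where
  edge: "tt_isomorphic K2 G \<Longrightarrow> series_parallel G"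
| parallel: "series_parallel G\<^sub>1 \<Longrightarrow> series_parallel G\<^sub>2 \<Longrightarrow> tt_isomorphic (parallel G\<^sub>1 G\<^sub>2) G
    \<Longrightarrow> series_parallel G"
| series: "series_parallel G\<^sub>1 \<Longrightarrow> series_parallel G\<^sub>2 \<Longrightarrow> tt_isomorphic (series G\<^sub>1 G\<^sub>2) G
    \<Longrightarrow> series_parallel G"

lemma glued_vertex_single:
  "glued_vertex {(a, b)} v = (if v \<in> {a, b} then {a, b} else {v})"
proof -
  have "(v, w) \<in> ({(a, b)} \<union> {(a, b)}\<inverse>)\<^sup>* \<Longrightarrow> w \<in> (if v \<in> {a, b} then {a, b} else {v})" for w
    by (induction rule: rtrancl_induct) (auto split: if_splits)
  then have "glued_vertex {(a, b)} v \<subseteq> (if v \<in> {a, b} then {a, b} else {v})"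
    unfolding glued_vertex_def by blast
  moreover have "(if v \<in> {a, b} then {a, b} else {v}) \<subseteq> glued_vertex {(a, b)} v"
    unfolding glued_vertex_def by auto
  ultimately show ?thesis by (rule subset_antisym)
qed

lemma glued_vertex_pair:
  assumes "a \<noteq> c" "a \<noteq> d" "b \<noteq> c" "b \<noteq> d"
  shows "glued_vertex {(a, b), (c, d)} v =
    (if v \<in> {a, b} then {a, b} else if v \<in> {c, d} then {c, d} else {v})"
proof -
  have "(v, w) \<in> ({(a, b), (c, d)} \<union> {(a, b), (c, d)}\<inverse>)\<^sup>* \<Longrightarrow>
      w \<in> (if v \<in> {a, b} then {a, b} else if v \<in> {c, d} then {c, d} else {v})" for w
    by (induction rule: rtrancl_induct) (use assms in \<open>auto split: if_splits\<close>)
  then have "glued_vertex {(a, b), (c, d)} v \<subseteq> (if v \<in> {a, b} then {a, b} else if v \<in> {c, d} then {c, d} else {v})"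
    unfolding glued_vertex_def by blast
  moreover have "(if v \<in> {a, b} then {a, b} else if v \<in> {c, d} then {c, d} else {v}) \<subseteq> glued_vertex {(a, b), (c, d)} v"
    unfolding glued_vertex_def by auto
  ultimately show ?thesis by (rule subset_antisym)
qed

definition wf_tt_graph :: "('v, 'e) tt_graph \<Rightarrow> bool" where
  "wf_tt_graph G \<longleftrightarrow> finite_multigraph G \<and> start_vertex G \<in> verts G \<and> end_vertex G \<in> verts G
     \<and> start_vertex G \<noteq> end_vertex G"

lemma tt_isomorphic_wf:
  assumes "tt_isomorphic G H" "wf_tt_graph G"
  shows "wf_tt_graph H"
proof -
  obtain f g where f: "bij_betw f (verts G) (verts H)" and g: "bij_betw g (edges G) (edges H)"
    and e: "\<forall>e\<in>edges G. ends H (g e) = map_uprod f (ends G e)"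
    and s: "f (start_vertex G) = start_vertex H" and t: "f (end_vertex G) = end_vertex H"
    using assms(1) unfolding tt_isomorphic_def by blast
  have "set_uprod (ends H e') \<subseteq> verts H" if "e' \<in> edges H" for e'
  proof -
    have "e' \<in> g ` edges G" using that bij_betw_imp_surj_on[OF g] by simp
    then obtain e where eG: "e \<in> edges G" "e' = g e" by (rule imageE)
    then have "set_uprod (ends H e') = f ` set_uprod (ends G e)" using bspec[OF e eG(1)] by (simp add: uprod.set_map)
    moreover have "set_uprod (ends G e) \<subseteq> verts G" using assms(2) eG(1)
      by (simp add: wf_tt_graph_def finite_multigraph_def)
    ultimately show ?thesis using bij_betw_imp_surj_on[OF f] by (metis image_mono)
  qed
  moreover have "finite (verts H)" "finite (edges H)"
    using bij_betw_finite[OF f] bij_betw_finite[OF g] assms(2) by (simp_all add: wf_tt_graph_def finite_multigraph_def)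
  moreover have "start_vertex H \<in> verts H" using assms(2) bij_betwE[OF f] s unfolding wf_tt_graph_def by metis
  moreover have "end_vertex H \<in> verts H" using assms(2) bij_betwE[OF f] t unfolding wf_tt_graph_def by metis
  moreover have "start_vertex H \<noteq> end_vertex H"
    using assms(2) inj_on_eq_iff[OF bij_betw_imp_inj_on[OF f]] s t unfolding wf_tt_graph_def by metis
  ultimately show ?thesis unfolding wf_tt_graph_def finite_multigraph_def by auto
qed

lemma parallel_wf: assumes "wf_tt_graph G" "wf_tt_graph H" shows "wf_tt_graph (parallel G H)"
proof -
  define c where "c = glued_vertex {(Inl (start_vertex G), Inr (start_vertex H)), (Inl (end_vertex G), Inr (end_vertex H))}"
  have n: "start_vertex G \<noteq> end_vertex G" "start_vertex H \<noteq> end_vertex H" using assms by (auto simp: wf_tt_graph_def)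
  have "c (Inl (start_vertex G)) \<noteq> c (Inl (end_vertex G))"
    unfolding c_def using n by (subst (1 2) glued_vertex_pair) auto
  then show ?thesis using assms
    unfolding wf_tt_graph_def finite_multigraph_def parallel_def disjoint_union_def Let_def c_def[symmetric]
    by (auto simp: uprod.set_map subset_iff intro!: imageI)
qed

lemma series_wf: assumes "wf_tt_graph G" "wf_tt_graph H" shows "wf_tt_graph (series G H)"
proof -
  define c where "c = glued_vertex {(Inl (end_vertex G), Inr (start_vertex H))}"
  have "c (Inl (start_vertex G)) \<noteq> c (Inr (end_vertex H))"
    using assms unfolding c_def wf_tt_graph_def by (subst (1 2) glued_vertex_single) auto
  then show ?thesis using assms
    unfolding wf_tt_graph_def finite_multigraph_def series_def disjoint_union_def Let_def c_def[symmetric]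
    by (auto simp: uprod.set_map subset_iff intro!: imageI)
qed

lemma K2_wf: "wf_tt_graph K2" by (auto simp: K2_def wf_tt_graph_def finite_multigraph_def)

lemma series_parallel_wf: "series_parallel G \<Longrightarrow> wf_tt_graph G"
proof (induction rule: series_parallel.induct)
  case (edge G) then show ?case using tt_isomorphic_wf K2_wf by blast
next
  case (parallel G1 G2 G) then show ?case using tt_isomorphic_wf parallel_wf by blast
next
  case (series G1 G2 G) then show ?case using tt_isomorphic_wf series_wf by blast
qed
end

theory Submission
  imports Defs "HOL-Complex_Analysis.Great_Picard"
begin

text \<open>
  For a two-terminal graph \<open>G\<close>, split the sum defining the chromatic polynomial into the part
  \<open>conn\<close> of edge sets that join the terminals and the part \<open>disc\<close> of those that do not, normalised
  such that \<open>Z = q * (conn + q * disc)\<close>. Two ratios describe how \<open>G\<close> behaves under composition: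
  \<open>y = (conn + disc) / disc\<close> is multiplicative under parallel composition, and
  \<open>g = (conn + q * disc) / conn\<close> is multiplicative under series composition
  (\<open>conn_disc_poly_parallel\<close>, \<open>conn_disc_poly_series\<close>). They are related by the involution
  \<open>y = 1 + q / (g - 1)\<close>, \<open>g = 1 + q / (y - 1)\<close>, and where both are defined and \<open>q \<noteq> 0\<close>, a zero
  of \<open>Z\<close> is a point with \<open>g = 0\<close>, that is,
  \<open>y = 1 - q\<close>.

  The functions \<open>y ^ k\<close>, realised by the \<open>k\<close>-fold parallel compositions of \<open>G\<close>, are far from a
  normal family at any point where a nonconstant \<open>y\<close> has modulus one. By the Picard-Schottky
  theorem they cannot all avoid \<open>1 - q\<close> there, so chromatic zeros accumulate
  (\<open>power_coincidence_if_moduli_cross\<close>, \<open>chromatic_zero_if_moduli_cross\<close>). It remains to find in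
  every open subset of the half-plane \<open>Re q > 3/2\<close> a series-parallel graph whose \<open>\<bar>y\<bar>\<close> crosses one.

  Under the involution, \<open>\<bar>y\<bar> > 1\<close> means that \<open>g\<close> is closer to \<open>1\<close> than to \<open>1 - q\<close>, and likewise with
  \<open>y\<close> and \<open>g\<close> exchanged. So if \<open>\<bar>g\<bar> > 1\<close> for a nonconstant \<open>g\<close>, then high powers of \<open>g\<close> rotate
  quickly around circles of large radius and visit both sides of the bisector
  (\<open>powers_cross_bisector\<close>), which makes \<open>\<bar>y\<bar>\<close> cross one for the corresponding series power. A graph
  with \<open>\<bar>g\<bar> > 1\<close> is found by the same lemma, applied to powers of some \<open>y\<close> with \<open>\<bar>y\<bar> > 1\<close>. The path of
  length two is such a start: its ratio \<open>y = (q - 1) / (q - 2)\<close> has modulus above one exactly in the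
  half-plane \<open>Re q > 3/2\<close>.

  The combinatorial part is a count of components: gluing two vertices lowers their number by one
  or, if the vertices are connected already, by zero (\<open>card_quotient_insert_pair\<close>).
\<close>

section \<open>Counting equivalence classes\<close>

text \<open>Every comparison of component counts below is between two graphs related by a vertex map \<open>c\<close>
  (an isomorphism, an inclusion into a disjoint union, or a gluing map), so one transfer principle
  for counting classes suffices.\<close>

lemma card_quotient_via_map:
  assumes r: "equiv UNIV r" and s: "equiv UNIV s"
    and rs: "\<And>u v. u \<in> V \<Longrightarrow> v \<in> V \<Longrightarrow> (c u, c v) \<in> s \<longleftrightarrow> (u, v) \<in> r"
  shows "card ((c ` V) // s) = card (V // r)"
proof -
  have class_eq: "r `` {u} = r `` {v} \<longleftrightarrow> s `` {c u} = s `` {c v}" if "u \<in> V" "v \<in> V" for u v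
    using that by (simp add: eq_equiv_class_iff[OF r] eq_equiv_class_iff[OF s] rs)
  (* a representative of each class, so that classes can be sent along c *)
  define pick where "pick = inv_into V (\<lambda>v. r `` {v})"
  have pick: "pick X \<in> V" "r `` {pick X} = X" if "X \<in> V // r" for X
  proof -
    have *: "X \<in> (\<lambda>v. r `` {v}) ` V" using that by (auto simp: quotient_def)
    then show "pick X \<in> V" "r `` {pick X} = X"
      unfolding pick_def using inv_into_into[OF *] f_inv_into_f[OF *] by simp_all
  qed
  have "bij_betw (\<lambda>X. s `` {c (pick X)}) (V // r) ((c ` V) // s)"
    unfolding bij_betw_def
  proof
    show "inj_on (\<lambda>X. s `` {c (pick X)}) (V // r)"
      by (rule inj_onI) (metis pick class_eq)
    show "(\<lambda>X. s `` {c (pick X)}) ` (V // r) = (c ` V) // s"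
    proof (intro equalityI subsetI)
      fix Y assume "Y \<in> (c ` V) // s"
      then obtain v where v: "v \<in> V" "Y = s `` {c v}" by (auto simp: quotient_def)
      then have "r `` {v} \<in> V // r" by (simp add: quotientI)
      with pick[OF this] v class_eq have "Y = s `` {c (pick (r `` {v}))}" by metis
      then show "Y \<in> (\<lambda>X. s `` {c (pick X)}) ` (V // r)" using \<open>r `` {v} \<in> V // r\<close> by blast
    qed (auto intro: quotientI pick)
  qed
  then show ?thesis by (simp add: bij_betw_same_card)
qed

lemma equiv_rtrancl_sym: "sym r \<Longrightarrow> equiv UNIV (r\<^sup>*)"
  by (simp add: equiv_def refl_rtrancl sym_rtrancl trans_rtrancl)

lemma rtrancl_insert_pair_iff:
  assumes "equiv UNIV r"
  shows "(x, y) \<in> (r \<union> {(a, b), (b, a)})\<^sup>* \<longleftrightarrow>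
    (x, y) \<in> r \<or> (x, a) \<in> r \<and> (b, y) \<in> r \<or> (x, b) \<in> r \<and> (a, y) \<in> r"
proof
  define K where "K u = r `` {u}" for u
  have r: "(u, v) \<in> r \<longleftrightarrow> K u = K v" for u v
    by (simp add: K_def eq_equiv_class_iff[OF assms])
  show "(x, y) \<in> r \<or> (x, a) \<in> r \<and> (b, y) \<in> r \<or> (x, b) \<in> r \<and> (a, y) \<in> r"
    if "(x, y) \<in> (r \<union> {(a, b), (b, a)})\<^sup>*"
    using that by (induction rule: rtrancl_induct) (auto simp: r)
  have sub: "(u, v) \<in> (r \<union> {(a, b), (b, a)})\<^sup>*" if "(u, v) \<in> r" for u v
    using that by auto
  have ab: "(a, b) \<in> (r \<union> {(a, b), (b, a)})\<^sup>*" "(b, a) \<in> (r \<union> {(a, b), (b, a)})\<^sup>*" by auto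
  assume "(x, y) \<in> r \<or> (x, a) \<in> r \<and> (b, y) \<in> r \<or> (x, b) \<in> r \<and> (a, y) \<in> r"
  then consider "(x, y) \<in> r" | "(x, a) \<in> r" "(b, y) \<in> r" | "(x, b) \<in> r" "(a, y) \<in> r" by blast
  then show "(x, y) \<in> (r \<union> {(a, b), (b, a)})\<^sup>*"
  proof cases
    case 1 then show ?thesis by (rule sub)
  next
    case 2 then show ?thesis using rtrancl_trans[OF rtrancl_trans[OF sub ab(1)] sub] by simp
  next
    case 3 then show ?thesis using rtrancl_trans[OF rtrancl_trans[OF sub ab(2)] sub] by simp
  qed
qed

lemma image_merge_values:
  assumes "a \<in> V"
  shows "(\<lambda>x. if K x = K a \<or> K x = K b then C else K x) ` V = insert C (K ` V - {K a, K b})"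
    (is "?m ` V = _")
proof
  show "insert C (K ` V - {K a, K b}) \<subseteq> ?m ` V"
  proof
    fix y assume y: "y \<in> insert C (K ` V - {K a, K b})"
    show "y \<in> ?m ` V"
    proof (cases "y = C")
      case True then show ?thesis using imageI[OF assms, of ?m] by simp
    next
      case False
      then obtain x where "x \<in> V" "y = K x" "K x \<noteq> K a" "K x \<noteq> K b" using y by auto
      then show ?thesis using imageI[of x V ?m] by simp
    qed
  qed
qed auto

lemma card_quotient_insert_pair:
  assumes r: "equiv UNIV r" and V: "finite V" "a \<in> V" "b \<in> V" and ab: "(a, b) \<notin> r"
  shows "Suc (card (V // (r \<union> {(a, b), (b, a)})\<^sup>*)) = card (V // r)"
proof -
  define K where "K u = r `` {u}" for u
  define r' where "r' = (r \<union> {(a, b), (b, a)})\<^sup>*"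
  have r_iff: "(u, v) \<in> r \<longleftrightarrow> K u = K v" for u v
    by (simp add: K_def eq_equiv_class_iff[OF r])
  have K_iff: "v \<in> K u \<longleftrightarrow> K u = K v" for u v
    by (simp add: K_def eq_equiv_class_iff[OF r])
  have merged: "r' `` {x} = (if K x = K a \<or> K x = K b then K a \<union> K b else K x)" for x
  proof (rule set_eqI)
    fix y
    have "y \<in> r' `` {x} \<longleftrightarrow> K x = K y \<or> K x = K a \<and> K b = K y \<or> K x = K b \<and> K a = K y"
      unfolding r'_def Image_singleton_iff rtrancl_insert_pair_iff[OF r] r_iff ..
    moreover have "y \<in> (if K x = K a \<or> K x = K b then K a \<union> K b else K x) \<longleftrightarrow>
        (if K x = K a \<or> K x = K b then K a = K y \<or> K b = K y else K x = K y)"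
      unfolding if_distrib[of "\<lambda>S. y \<in> S"] Un_iff K_iff ..
    ultimately show "y \<in> r' `` {x} \<longleftrightarrow> y \<in> (if K x = K a \<or> K x = K b then K a \<union> K b else K x)"
      by metis
  qed
  have quot: "V // r = K ` V" by (auto simp: quotient_def K_def)
  have AB: "K a \<noteq> K b" "K a \<in> V // r" "K b \<in> V // r"
    using ab V by (auto simp: quot r_iff)
  have "K a \<union> K b \<notin> V // r - {K a, K b}"
  proof
    assume "K a \<union> K b \<in> V // r - {K a, K b}"
    then obtain x where x: "K a \<union> K b = K x" "K a \<union> K b \<noteq> K a" by (auto simp: quot)
    moreover have "a \<in> K a \<union> K b" by (simp add: K_iff)
    ultimately have "K x = K a" using K_iff by metis
    then show False using x by simp
  qed
  moreover have "V // r' = insert (K a \<union> K b) (V // r - {K a, K b})"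
  proof -
    have "V // r' = (\<lambda>x. if K x = K a \<or> K x = K b then K a \<union> K b else K x) ` V"
      by (simp only: quotient_def merged UNION_singleton_eq_range)
    also have "\<dots> = insert (K a \<union> K b) (K ` V - {K a, K b})"
      using V(2) by (rule image_merge_values)
    finally show ?thesis by (simp add: quot)
  qed
  moreover have fin: "finite (V // r)" using V by (simp add: quot)
  moreover have "card {K a, K b} \<le> card (V // r)" using AB fin by (intro card_mono) auto
  ultimately show ?thesis using AB
    by (simp add: r'_def card_Diff_subset)
qed

section \<open>Components under vertex maps\<close>

lemma adjacent_via_sym: "sym (adjacent_via G F)"
proof (rule symI)
  fix u v assume "(u, v) \<in> adjacent_via G F"
  then obtain e where "e \<in> F" "ends G e = Upair u v" by (auto simp: adjacent_via_def)
  then have "e \<in> F" "ends G e = Upair v u" by simp_all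
  then show "(v, u) \<in> adjacent_via G F" by (auto simp: adjacent_via_def)
qed

lemma equiv_adjacent_via: "equiv UNIV ((adjacent_via G F)\<^sup>*)"
  by (rule equiv_rtrancl_sym) (rule adjacent_via_sym)

lemma adjacent_via_Un: "adjacent_via G (F \<union> F') = adjacent_via G F \<union> adjacent_via G F'"
  by (auto simp: adjacent_via_def)

lemma adjacent_via_image:
  assumes "\<And>e. e \<in> F \<Longrightarrow> ends H (g e) = map_uprod f (ends G e)"
  shows "adjacent_via H (g ` F) = map_prod f f ` adjacent_via G F"
proof (intro equalityI subsetI)
  fix p assume "p \<in> adjacent_via H (g ` F)"
  then obtain e u v where e: "e \<in> F" "map_uprod f (ends G e) = Upair u v" "p = (u, v)"
    using assms by (auto simp: adjacent_via_def)
  obtain a b where ab: "ends G e = Upair a b" by (rule uprod_exhaust)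
  with e have "u = f a \<and> v = f b \<or> u = f b \<and> v = f a" by auto
  moreover have "(a, b) \<in> adjacent_via G F" "(b, a) \<in> adjacent_via G F"
    using ab e(1) by (force simp: adjacent_via_def)+
  ultimately show "p \<in> map_prod f f ` adjacent_via G F" using e(3) by force
next
  fix p assume "p \<in> map_prod f f ` adjacent_via G F"
  then show "p \<in> adjacent_via H (g ` F)" using assms by (force simp: adjacent_via_def)
qed

lemma adjacent_via_subset_verts:
  assumes "finite_multigraph G" "F \<subseteq> edges G"
  shows "adjacent_via G F \<subseteq> verts G \<times> verts G"
  using assms unfolding adjacent_via_def finite_multigraph_def by force

text \<open>A path in the image of a relation lifts to a path upstairs once jumps inside the fibres of \<open>f\<close>
  are allowed: consecutive image edges meet in a point of the image, but their preimages only meet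
  up to a fibre.\<close>

lemma rtrancl_map_prod_iff:
  assumes r: "r \<subseteq> V \<times> V" and u: "u \<in> V" and v: "v \<in> V"
  shows "(f u, f v) \<in> (map_prod f f ` r)\<^sup>* \<longleftrightarrow> (u, v) \<in> (r \<union> {(x, y) \<in> V \<times> V. f x = f y})\<^sup>*"
    (is "_ \<longleftrightarrow> _ \<in> ?R\<^sup>*")
proof
  have "\<forall>w\<in>V. w' = f w \<longrightarrow> (u, w) \<in> ?R\<^sup>*" if "(f u, w') \<in> (map_prod f f ` r)\<^sup>*" for w'
    using that
  proof (induction rule: rtrancl_induct)
    case base
    then show ?case using u by auto
  next
    case (step y z)
    then obtain a b where ab: "(a, b) \<in> r" "y = f a" "z = f b" by auto
    then have "a \<in> V" "b \<in> V" using r by auto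
    then have "(u, a) \<in> ?R\<^sup>*" using step.IH ab by blast
    also have "(a, b) \<in> ?R\<^sup>*" using ab by auto
    finally have "(u, b) \<in> ?R\<^sup>*" .
    moreover have "(b, w) \<in> ?R" if "w \<in> V" "z = f w" for w using that \<open>b \<in> V\<close> ab by auto
    ultimately show ?case by (meson rtrancl.rtrancl_into_rtrancl)
  qed
  then show "(u, v) \<in> ?R\<^sup>*" if "(f u, f v) \<in> (map_prod f f ` r)\<^sup>*" using that v by blast
next
  assume "(u, v) \<in> ?R\<^sup>*"
  then show "(f u, f v) \<in> (map_prod f f ` r)\<^sup>*"
  proof (induction rule: rtrancl_induct)
    case base show ?case by simp
  next
    case (step y z)
    show ?case
    proof (cases "(y, z) \<in> r")
      case True
      then have "(f y, f z) \<in> map_prod f f ` r" by force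
      with step.IH show ?thesis by (rule rtrancl_into_rtrancl)
    next
      case False
      then show ?thesis using step by auto
    qed
  qed
qed

text \<open>Here \<open>f\<close> may identify vertices and \<open>g\<close> relabels edges. Keeping both general lets the same two
  statements treat graph isomorphisms (where the fibres are trivial) and the quotient maps of the
  series and parallel compositions (where \<open>g\<close> is the identity).\<close>

lemma connected_glue_iff:
  assumes G: "finite_multigraph G" and F: "F \<subseteq> edges G"
    and ends: "\<And>e. e \<in> F \<Longrightarrow> ends H (g e) = map_uprod f (ends G e)"
    and uv: "u \<in> verts G" "v \<in> verts G"
  shows "(f u, f v) \<in> (adjacent_via H (g ` F))\<^sup>* \<longleftrightarrow>
    (u, v) \<in> (adjacent_via G F \<union> {(x, y) \<in> verts G \<times> verts G. f x = f y})\<^sup>*"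
  using rtrancl_map_prod_iff[OF adjacent_via_subset_verts[OF G F] uv, of f]
  by (simp add: adjacent_via_image[of F H g f G, OF ends])

lemma num_components_glue:
  assumes G: "finite_multigraph G" and F: "F \<subseteq> edges G"
    and ends: "\<And>e. e \<in> F \<Longrightarrow> ends H (g e) = map_uprod f (ends G e)"
    and H: "verts H = f ` verts G"
  shows "num_components H (g ` F) =
    card (verts G // (adjacent_via G F \<union> {(x, y) \<in> verts G \<times> verts G. f x = f y})\<^sup>*)"
proof -
  have "sym (adjacent_via G F \<union> {(x, y) \<in> verts G \<times> verts G. f x = f y})"
    by (intro sym_Un adjacent_via_sym symI) auto
  then show ?thesis
    unfolding num_components_def H
    by (intro card_quotient_via_map equiv_rtrancl_sym adjacent_via_sym
        connected_glue_iff[OF G F ends])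
qed

section \<open>Disjoint unions and gluing\<close>

lemma adjacent_via_disjoint_union:
  "adjacent_via (disjoint_union G H) (F\<^sub>1 <+> F\<^sub>2) =
    map_prod Inl Inl ` adjacent_via G F\<^sub>1 \<union> map_prod Inr Inr ` adjacent_via H F\<^sub>2"
  unfolding Plus_def adjacent_via_Un
  by (intro arg_cong2[of _ _ _ _ "(\<union>)"] adjacent_via_image) (simp_all add: disjoint_union_def)

lemma rtrancl_disjoint_sum:
  defines "R r s \<equiv> (map_prod Inl Inl ` r \<union> map_prod Inr Inr ` s)\<^sup>*"
  shows "(Inl u, Inl v) \<in> R r s \<longleftrightarrow> (u, v) \<in> r\<^sup>*"
    and "(Inr w, Inr z) \<in> R r s \<longleftrightarrow> (w, z) \<in> s\<^sup>*"
    and "(Inl u, Inr z) \<notin> R r s" and "(Inr w, Inl v) \<notin> R r s"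
proof -
  have from_l: "\<exists>v. y = Inl v \<and> (u, v) \<in> r\<^sup>*" if "(Inl u, y) \<in> R r s" for y
    using that unfolding R_def
    by (induction rule: rtrancl_induct) (auto intro: rtrancl_into_rtrancl)
  have from_r: "\<exists>v. y = Inr v \<and> (w, v) \<in> s\<^sup>*" if "(Inr w, y) \<in> R r s" for y
    using that unfolding R_def
    by (induction rule: rtrancl_induct) (auto intro: rtrancl_into_rtrancl)
  have to_l: "(Inl u, Inl v) \<in> R r s" if "(u, v) \<in> r\<^sup>*" for v
    using that unfolding R_def
  proof (induction rule: rtrancl_induct)
    case (step y z)
    then have "(Inl y, Inl z) \<in> map_prod Inl Inl ` r" by force
    then show ?case by (intro rtrancl_into_rtrancl[OF step.IH]) blast
  qed simp
  have to_r: "(Inr w, Inr z) \<in> R r s" if "(w, z) \<in> s\<^sup>*" for z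
    using that unfolding R_def
  proof (induction rule: rtrancl_induct)
    case (step y z)
    then have "(Inr y, Inr z) \<in> map_prod Inr Inr ` s" by force
    then show ?case by (intro rtrancl_into_rtrancl[OF step.IH]) blast
  qed simp
  show "(Inl u, Inl v) \<in> R r s \<longleftrightarrow> (u, v) \<in> r\<^sup>*" using from_l to_l by blast
  show "(Inr w, Inr z) \<in> R r s \<longleftrightarrow> (w, z) \<in> s\<^sup>*" using from_r to_r by blast
  show "(Inl u, Inr z) \<notin> R r s" using from_l by blast
  show "(Inr w, Inl v) \<notin> R r s" using from_r by blast
qed

lemmas connected_disjoint_union =
  rtrancl_disjoint_sum[of _ _ "adjacent_via G F\<^sub>1" "adjacent_via H F\<^sub>2" for G H F\<^sub>1 F\<^sub>2,
    folded adjacent_via_disjoint_union]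

lemma num_components_disjoint_union:
  assumes "finite (verts G)" "finite (verts H)"
  shows "num_components (disjoint_union G H) (F\<^sub>1 <+> F\<^sub>2) = num_components G F\<^sub>1 + num_components H F\<^sub>2"
proof -
  define r where "r = (adjacent_via (disjoint_union G H) (F\<^sub>1 <+> F\<^sub>2))\<^sup>*"
  have r: "equiv UNIV r" unfolding r_def by (rule equiv_adjacent_via)
  have "card ((Inl ` verts G) // r) = num_components G F\<^sub>1"
    unfolding num_components_def
    by (rule card_quotient_via_map[OF equiv_adjacent_via r])
       (simp add: r_def connected_disjoint_union)
  moreover have "card ((Inr ` verts H) // r) = num_components H F\<^sub>2"
    unfolding num_components_def
    by (rule card_quotient_via_map[OF equiv_adjacent_via r])
       (simp add: r_def connected_disjoint_union)
  moreover have "(Inl ` verts G) // r \<inter> (Inr ` verts H) // r = {}"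
  proof -
    have "r `` {Inl u} \<noteq> r `` {Inr w}" for u w
      unfolding eq_equiv_class_iff[OF r UNIV_I UNIV_I] by (simp add: r_def connected_disjoint_union)
    then show ?thesis unfolding quotient_def by blast
  qed
  moreover have "finite ((Inl ` verts G) // r)" "finite ((Inr ` verts H) // r)"
    using assms by (simp_all add: quotient_def)
  moreover have "verts (disjoint_union G H) // r = (Inl ` verts G) // r \<union> (Inr ` verts H) // r"
    by (simp add: disjoint_union_def quotient_def Plus_def)
  ultimately show ?thesis
    by (simp add: num_components_def[of "disjoint_union G H"] card_Un_disjoint flip: r_def)
qed

lemma rtrancl_Un_left: "(r\<^sup>* \<union> s)\<^sup>* = (r \<union> s)\<^sup>*"
proof (rule rtrancl_subset)
  show "r\<^sup>* \<union> s \<subseteq> (r \<union> s)\<^sup>*" using rtrancl_mono[of r "r \<union> s"] by auto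
qed auto

text \<open>The fibres of a gluing map generate the same connectivity as the prescribed pairs themselves.
  This turns gluing into adding finitely many pairs, each of which is handled by
  \<open>card_quotient_insert_pair\<close>.\<close>

lemma rtrancl_glued_vertex:
  assumes "R \<subseteq> V \<times> V"
  shows "(r \<union> {(x, y) \<in> V \<times> V. glued_vertex R x = glued_vertex R y})\<^sup>* = (r \<union> (R \<union> R\<inverse>))\<^sup>*"
proof (rule rtrancl_subset)
  have "equiv UNIV ((R \<union> R\<inverse>)\<^sup>*)" by (intro equiv_rtrancl_sym symI) auto
  then have eq: "glued_vertex R x = glued_vertex R y \<longleftrightarrow> (x, y) \<in> (R \<union> R\<inverse>)\<^sup>*" for x y
    unfolding glued_vertex_def by (simp add: eq_equiv_class_iff)
  have "(R \<union> R\<inverse>)\<^sup>* \<subseteq> (r \<union> (R \<union> R\<inverse>))\<^sup>*" by (intro rtrancl_mono) auto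
  then show "r \<union> {(x, y) \<in> V \<times> V. glued_vertex R x = glued_vertex R y} \<subseteq> (r \<union> (R \<union> R\<inverse>))\<^sup>*"
    by (auto simp: eq)
  show "r \<union> (R \<union> R\<inverse>) \<subseteq> r \<union> {(x, y) \<in> V \<times> V. glued_vertex R x = glued_vertex R y}"
    using assms by (auto simp: eq)
qed

section \<open>Compositions and the terminals\<close>

definition connects_terminals :: "('v, 'e) tt_graph \<Rightarrow> 'e set \<Rightarrow> bool" where
  "connects_terminals G F \<longleftrightarrow> (start_vertex G, end_vertex G) \<in> (adjacent_via G F)\<^sup>*"

lemma num_components_ge:
  assumes "wf_tt_graph G"
  shows "1 \<le> num_components G F" and "\<not> connects_terminals G F \<Longrightarrow> 2 \<le> num_components G F"
proof -
  define K where "K v = (adjacent_via G F)\<^sup>* `` {v}" for v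
  have fin: "finite (verts G // (adjacent_via G F)\<^sup>*)"
    using assms by (simp add: wf_tt_graph_def finite_multigraph_def quotient_def)
  have sub: "{K (start_vertex G), K (end_vertex G)} \<subseteq> verts G // (adjacent_via G F)\<^sup>*"
    using assms by (auto simp: K_def wf_tt_graph_def intro: quotientI)
  have card: "card {K (start_vertex G), K (end_vertex G)} \<le> num_components G F"
    unfolding num_components_def by (rule card_mono[OF fin sub])
  have "1 \<le> card {K (start_vertex G), K (end_vertex G)}"
    by (simp add: card_insert_if)
  with card show "1 \<le> num_components G F" by simp
  assume "\<not> connects_terminals G F"
  then have "K (start_vertex G) \<noteq> K (end_vertex G)"
    unfolding K_def eq_equiv_class_iff[OF equiv_adjacent_via UNIV_I UNIV_I]
    by (simp add: connects_terminals_def)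
  with card show "2 \<le> num_components G F" by simp
qed

lemma finite_multigraph_disjoint_union:
  assumes "finite_multigraph G" "finite_multigraph H"
  shows "finite_multigraph (disjoint_union G H)"
  using assms by (fastforce simp: finite_multigraph_def disjoint_union_def uprod.set_map)

text \<open>Gluing the start vertices always merges two components, as they lie in different summands. Gluing
  the end vertices then merges two more, unless they are already connected, which by now happens
  exactly when both factors connect their terminals.\<close>

lemma
  fixes G :: "('v, 'e) tt_graph" and H :: "('w, 'f) tt_graph"
  assumes G: "wf_tt_graph G" "F\<^sub>1 \<subseteq> edges G" and H: "wf_tt_graph H" "F\<^sub>2 \<subseteq> edges H"
  shows connects_terminals_parallel:
      "connects_terminals (parallel G H) (F\<^sub>1 <+> F\<^sub>2) \<longleftrightarrow>
        connects_terminals G F\<^sub>1 \<or> connects_terminals H F\<^sub>2"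
    and num_components_parallel:
      "num_components (parallel G H) (F\<^sub>1 <+> F\<^sub>2) =
        (if connects_terminals G F\<^sub>1 \<and> connects_terminals H F\<^sub>2
         then num_components G F\<^sub>1 + num_components H F\<^sub>2 - 1
         else num_components G F\<^sub>1 + num_components H F\<^sub>2 - 2)"
proof -
  define D where "D = disjoint_union G H"
  define F where "F = F\<^sub>1 <+> F\<^sub>2"
  define a b c d :: "'v + 'w" where abcd: "a = Inl (start_vertex G)" "b = Inr (start_vertex H)"
    "c = Inl (end_vertex G)" "d = Inr (end_vertex H)"
  define R where "R = {(a, b), (c, d)}"
  define r where "r = (adjacent_via D F)\<^sup>*"
  (* r: connectivity in the disjoint union; r', r'': after gluing the starts, then the ends *)
  define r' where "r' = (r \<union> {(a, b), (b, a)})\<^sup>*"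
  define r'' where "r'' = (r' \<union> {(c, d), (d, c)})\<^sup>*"
  have D: "finite_multigraph D" and F: "F \<subseteq> edges D"
    using assms finite_multigraph_disjoint_union[of G H]
    by (auto simp: D_def wf_tt_graph_def F_def disjoint_union_def)
  have abcd_in: "a \<in> verts D" "b \<in> verts D" "c \<in> verts D" "d \<in> verts D"
    using G H by (auto simp: abcd D_def disjoint_union_def wf_tt_graph_def)
  have r: "equiv UNIV r" unfolding r_def by (rule equiv_adjacent_via)
  then have "sym r" by (simp add: equiv_def)
  then have r': "equiv UNIV r'" unfolding r'_def
    by (intro equiv_rtrancl_sym sym_Un symI[of "{(a, b), (b, a)}"]) auto
  have "(adjacent_via D F \<union> {(x, y) \<in> verts D \<times> verts D. glued_vertex R x = glued_vertex R y})\<^sup>*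
      = (adjacent_via D F \<union> (R \<union> R\<inverse>))\<^sup>*"
    using abcd_in by (intro rtrancl_glued_vertex) (auto simp: R_def)
  also have "R \<union> R\<inverse> = {(a, b), (b, a)} \<union> {(c, d), (d, c)}" by (auto simp: R_def)
  finally have glue: "(adjacent_via D F \<union> {(x, y) \<in> verts D \<times> verts D. glued_vertex R x = glued_vertex R y})\<^sup>* = r''"
    by (simp only: r''_def r'_def r_def rtrancl_Un_left Un_assoc)
  have ends: "ends (parallel G H) (id e) = map_uprod (glued_vertex R) (ends D e)"
    "verts (parallel G H) = glued_vertex R ` verts D"
    "start_vertex (parallel G H) = glued_vertex R a" "end_vertex (parallel G H) = glued_vertex R c" for e
    by (simp_all add: parallel_def Let_def D_def R_def abcd)
  have r_simps: "(a, b) \<notin> r" "(a, d) \<notin> r" "(c, b) \<notin> r" "(c, d) \<notin> r" "(b, a) \<notin> r" "(b, c) \<notin> r" "(d, a) \<notin> r" "(d, c) \<notin> r"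
    "(a, c) \<in> r \<longleftrightarrow> connects_terminals G F\<^sub>1" "(b, d) \<in> r \<longleftrightarrow> connects_terminals H F\<^sub>2"
    unfolding r_def D_def F_def abcd by (simp_all add: connected_disjoint_union connects_terminals_def)
  have r_sym: "(c, a) \<in> r \<longleftrightarrow> (a, c) \<in> r" "(d, b) \<in> r \<longleftrightarrow> (b, d) \<in> r" and r_refl: "(x, x) \<in> r" for x
    using \<open>sym r\<close> r by (auto simp: equiv_def refl_on_def dest: symD)
  have cd: "(c, d) \<in> r' \<longleftrightarrow> connects_terminals G F\<^sub>1 \<and> connects_terminals H F\<^sub>2"
    unfolding r'_def rtrancl_insert_pair_iff[OF r] by (simp add: r_simps r_sym)
  have "(a, c) \<in> r'' \<longleftrightarrow> connects_terminals G F\<^sub>1 \<or> connects_terminals H F\<^sub>2"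
    unfolding r''_def rtrancl_insert_pair_iff[OF r']
    unfolding r'_def rtrancl_insert_pair_iff[OF r] by (auto simp: r_simps r_sym r_refl)
  then show "connects_terminals (parallel G H) (F\<^sub>1 <+> F\<^sub>2) \<longleftrightarrow>
        connects_terminals G F\<^sub>1 \<or> connects_terminals H F\<^sub>2"
    using connected_glue_iff[OF D F ends(1) abcd_in(1,3), unfolded glue]
    by (simp add: connects_terminals_def[of "parallel G H"] ends F_def)
  have finV: "finite (verts D)" using D by (simp add: finite_multigraph_def)
  have "card (verts D // r) = num_components G F\<^sub>1 + num_components H F\<^sub>2"
    using num_components_disjoint_union[of G H F\<^sub>1 F\<^sub>2] G H
    by (simp add: num_components_def[of "disjoint_union G H"] r_def D_def F_def wf_tt_graph_def finite_multigraph_def)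
  moreover have "Suc (card (verts D // r')) = card (verts D // r)"
    unfolding r'_def by (rule card_quotient_insert_pair[OF r finV abcd_in(1,2) r_simps(1)])
  moreover have "card (verts D // r'') = (if (c, d) \<in> r' then card (verts D // r') else card (verts D // r') - 1)"
  proof (cases "(c, d) \<in> r'")
    case True
    then have "(d, c) \<in> r'" using r' by (auto simp: equiv_def dest: symD)
    with True have "r'' = r'\<^sup>*" by (simp add: r''_def insert_absorb)
    also have "\<dots> = r'" by (simp add: r'_def)
    finally show ?thesis using True by simp
  next
    case False
    then show ?thesis using card_quotient_insert_pair[OF r' finV abcd_in(3,4)] by (simp add: r''_def flip: diff_Suc_1)
  qed
  moreover have "num_components (parallel G H) (F\<^sub>1 <+> F\<^sub>2) = card (verts D // r'')"
    using num_components_glue[OF D F ends(1,2), unfolded glue] by (simp add: F_def)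
  ultimately show "num_components (parallel G H) (F\<^sub>1 <+> F\<^sub>2) =
        (if connects_terminals G F\<^sub>1 \<and> connects_terminals H F\<^sub>2
         then num_components G F\<^sub>1 + num_components H F\<^sub>2 - 1
         else num_components G F\<^sub>1 + num_components H F\<^sub>2 - 2)"
    unfolding cd by (cases "connects_terminals G F\<^sub>1 \<and> connects_terminals H F\<^sub>2") auto
qed

lemma
  fixes G :: "('v, 'e) tt_graph" and H :: "('w, 'f) tt_graph"
  assumes G: "wf_tt_graph G" "F\<^sub>1 \<subseteq> edges G" and H: "wf_tt_graph H" "F\<^sub>2 \<subseteq> edges H"
  shows connects_terminals_series:
      "connects_terminals (series G H) (F\<^sub>1 <+> F\<^sub>2) \<longleftrightarrow>
        connects_terminals G F\<^sub>1 \<and> connects_terminals H F\<^sub>2"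
    and num_components_series:
      "num_components (series G H) (F\<^sub>1 <+> F\<^sub>2) = num_components G F\<^sub>1 + num_components H F\<^sub>2 - 1"
proof -
  define D where "D = disjoint_union G H"
  define F where "F = F\<^sub>1 <+> F\<^sub>2"
  define a b c d :: "'v + 'w" where abcd: "a = Inl (end_vertex G)" "b = Inr (start_vertex H)"
    "c = Inl (start_vertex G)" "d = Inr (end_vertex H)"
  define R where "R = {(a, b)}"
  define r where "r = (adjacent_via D F)\<^sup>*"
  define r' where "r' = (r \<union> {(a, b), (b, a)})\<^sup>*"
  have D: "finite_multigraph D" and F: "F \<subseteq> edges D"
    using assms finite_multigraph_disjoint_union[of G H]
    by (auto simp: D_def wf_tt_graph_def F_def disjoint_union_def)
  have abcd_in: "a \<in> verts D" "b \<in> verts D" "c \<in> verts D" "d \<in> verts D"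
    using G H by (auto simp: abcd D_def disjoint_union_def wf_tt_graph_def)
  have r: "equiv UNIV r" unfolding r_def by (rule equiv_adjacent_via)
  have "(adjacent_via D F \<union> {(x, y) \<in> verts D \<times> verts D. glued_vertex R x = glued_vertex R y})\<^sup>*
      = (adjacent_via D F \<union> (R \<union> R\<inverse>))\<^sup>*"
    using abcd_in by (intro rtrancl_glued_vertex) (auto simp: R_def)
  also have "R \<union> R\<inverse> = {(a, b), (b, a)}" by (auto simp: R_def)
  finally have glue: "(adjacent_via D F \<union> {(x, y) \<in> verts D \<times> verts D. glued_vertex R x = glued_vertex R y})\<^sup>* = r'"
    by (simp only: r'_def r_def rtrancl_Un_left)
  have ends: "ends (series G H) (id e) = map_uprod (glued_vertex R) (ends D e)"
    "verts (series G H) = glued_vertex R ` verts D"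
    "start_vertex (series G H) = glued_vertex R c" "end_vertex (series G H) = glued_vertex R d" for e
    by (simp_all add: series_def Let_def D_def R_def abcd)
  have r_simps: "(a, b) \<notin> r" "(c, d) \<notin> r" "(c, b) \<notin> r"
    "(c, a) \<in> r \<longleftrightarrow> connects_terminals G F\<^sub>1" "(b, d) \<in> r \<longleftrightarrow> connects_terminals H F\<^sub>2"
    unfolding r_def D_def F_def abcd by (simp_all add: connected_disjoint_union connects_terminals_def)
  have "(c, d) \<in> r' \<longleftrightarrow> connects_terminals G F\<^sub>1 \<and> connects_terminals H F\<^sub>2"
    unfolding r'_def rtrancl_insert_pair_iff[OF r] by (simp add: r_simps)
  then show "connects_terminals (series G H) (F\<^sub>1 <+> F\<^sub>2) \<longleftrightarrow>
        connects_terminals G F\<^sub>1 \<and> connects_terminals H F\<^sub>2"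
    using connected_glue_iff[OF D F ends(1) abcd_in(3,4), unfolded glue]
    by (simp add: connects_terminals_def[of "series G H"] ends F_def)
  have finV: "finite (verts D)" using D by (simp add: finite_multigraph_def)
  have "card (verts D // r) = num_components G F\<^sub>1 + num_components H F\<^sub>2"
    using num_components_disjoint_union[of G H F\<^sub>1 F\<^sub>2] G H
    by (simp add: num_components_def[of "disjoint_union G H"] r_def D_def F_def wf_tt_graph_def finite_multigraph_def)
  moreover have "Suc (card (verts D // r')) = card (verts D // r)"
    unfolding r'_def by (rule card_quotient_insert_pair[OF r finV abcd_in(1,2) r_simps(1)])
  moreover have "num_components (series G H) (F\<^sub>1 <+> F\<^sub>2) = card (verts D // r')"
    using num_components_glue[OF D F ends(1,2), unfolded glue] by (simp add: F_def)
  ultimately show "num_components (series G H) (F\<^sub>1 <+> F\<^sub>2) = num_components G F\<^sub>1 + num_components H F\<^sub>2 - 1"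
    by simp
qed

lemma
  assumes G: "wf_tt_graph G" and f: "bij_betw f (verts G) (verts H)"
    and ends: "\<And>e. e \<in> edges G \<Longrightarrow> ends H (g e) = map_uprod f (ends G e)"
    and st: "f (start_vertex G) = start_vertex H" "f (end_vertex G) = end_vertex H"
    and F: "F \<subseteq> edges G"
  shows connects_terminals_isomorphic: "connects_terminals H (g ` F) \<longleftrightarrow> connects_terminals G F"
    and num_components_isomorphic: "num_components H (g ` F) = num_components G F"
proof -
  have fin: "finite_multigraph G" and V: "start_vertex G \<in> verts G" "end_vertex G \<in> verts G"
    using G by (simp_all add: wf_tt_graph_def)
  have ends': "ends H (g e) = map_uprod f (ends G e)" if "e \<in> F" for e
    using that F ends by blast
  have "{(x, y) \<in> verts G \<times> verts G. f x = f y} \<subseteq> Id"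
    using f by (auto simp: bij_betw_def dest: inj_onD)
  then have trivial: "(adjacent_via G F \<union> {(x, y) \<in> verts G \<times> verts G. f x = f y})\<^sup>* = (adjacent_via G F)\<^sup>*"
    by (intro rtrancl_subset) auto
  show "connects_terminals H (g ` F) \<longleftrightarrow> connects_terminals G F"
    using connected_glue_iff[of G F H g f, OF fin F ends' V, unfolded trivial] by (simp add: connects_terminals_def st)
  show "num_components H (g ` F) = num_components G F"
    using num_components_glue[of G F H g f, OF fin F ends', unfolded trivial] f
    by (simp add: num_components_def[of G] bij_betw_def)
qed

section \<open>The two parts of the chromatic polynomial\<close>

text \<open>The sum over edge sets splits according to whether an edge set joins the two terminals. The powers
  of \<open>q\<close> are lowered by the number of components that contain a terminal (one or two). With this
  normalisation both compositions become multiplicative without correction factors, as identities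
  of polynomials that also hold at \<open>q = 0\<close>.\<close>

definition conn_term :: "('v, 'e) tt_graph \<Rightarrow> 'a::comm_ring_1 \<Rightarrow> 'e set \<Rightarrow> 'a" where
  "conn_term G q F = (if connects_terminals G F then (- 1) ^ card F * q ^ (num_components G F - 1) else 0)"

definition disc_term :: "('v, 'e) tt_graph \<Rightarrow> 'a::comm_ring_1 \<Rightarrow> 'e set \<Rightarrow> 'a" where
  "disc_term G q F = (if connects_terminals G F then 0 else (- 1) ^ card F * q ^ (num_components G F - 2))"

definition conn_poly :: "('v, 'e) tt_graph \<Rightarrow> 'a::comm_ring_1 \<Rightarrow> 'a" where
  "conn_poly G q = (\<Sum>F\<in>Pow (edges G). conn_term G q F)"

definition disc_poly :: "('v, 'e) tt_graph \<Rightarrow> 'a::comm_ring_1 \<Rightarrow> 'a" where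
  "disc_poly G q = (\<Sum>F\<in>Pow (edges G). disc_term G q F)"

lemma chromatic_polynomial_split:
  assumes "wf_tt_graph G"
  shows "chromatic_polynomial G q = q * (conn_poly G q + q * disc_poly G q)"
proof -
  have "(- 1) ^ card F * q ^ num_components G F = q * (conn_term G q F + q * disc_term G q F)" for F
    using num_components_ge[OF assms, of F]
    by (cases "num_components G F"; cases "num_components G F - 1")
       (auto simp: conn_term_def disc_term_def)
  then show ?thesis
    by (simp add: chromatic_polynomial_def conn_poly_def disc_poly_def sum.distrib flip: sum_distrib_left)
qed

lemma sum_Pow_Plus: "(\<Sum>F\<in>Pow (A <+> B). h F) = (\<Sum>F\<^sub>1\<in>Pow A. \<Sum>F\<^sub>2\<in>Pow B. h (F\<^sub>1 <+> F\<^sub>2))"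
proof -
  have "bij_betw (\<lambda>(F\<^sub>1, F\<^sub>2). F\<^sub>1 <+> F\<^sub>2) (Pow A \<times> Pow B) (Pow (A <+> B))"
    by (rule bij_betw_byWitness[where f' = "\<lambda>F. (Inl -` F, Inr -` F)"]) auto
  then show ?thesis
    by (simp add: sum.reindex_bij_betw[symmetric] sum.cartesian_product case_prod_unfold)
qed

lemma sum_Pow_Plus_product:
  fixes f :: "'e set \<Rightarrow> 'a::comm_ring_1"
  assumes "\<And>F\<^sub>1 F\<^sub>2. F\<^sub>1 \<subseteq> A \<Longrightarrow> F\<^sub>2 \<subseteq> B \<Longrightarrow> h (F\<^sub>1 <+> F\<^sub>2) = f F\<^sub>1 * g F\<^sub>2"
  shows "(\<Sum>F\<in>Pow (A <+> B). h F) = (\<Sum>F\<in>Pow A. f F) * (\<Sum>F\<in>Pow B. g F)"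
  unfolding sum_Pow_Plus sum_product by (intro sum.cong refl assms) auto

lemma edges_parallel [simp]: "edges (parallel G H) = edges G <+> edges H"
  and edges_series [simp]: "edges (series G H) = edges G <+> edges H"
  by (simp_all add: parallel_def series_def disjoint_union_def Let_def)

lemma card_Plus_subset:
  assumes "wf_tt_graph G" "wf_tt_graph H" "F\<^sub>1 \<subseteq> edges G" "F\<^sub>2 \<subseteq> edges H"
  shows "card (F\<^sub>1 <+> F\<^sub>2) = card F\<^sub>1 + card F\<^sub>2"
  using assms by (intro card_Plus) (auto simp: wf_tt_graph_def finite_multigraph_def intro: finite_subset)

text \<open>Both identities already hold for each pair of edge sets. An edge set of a parallel composition
  separates the terminals only if both parts do, so \<open>disc\<close> is multiplicative; and lowering the
  power of \<open>q\<close> by the number of terminal components makes the weight of every pair a product, so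
  \<open>conn + disc\<close> is multiplicative too. (Counting colourings, \<open>conn + disc\<close> is, up to a factor \<open>q\<close>, the
  chromatic polynomial of the graph with its terminals identified, and these graphs are glued at a
  vertex.)\<close>

lemma
  assumes G: "wf_tt_graph G" and H: "wf_tt_graph H"
  shows disc_poly_parallel: "disc_poly (parallel G H) q = disc_poly G q * disc_poly H q"
    and conn_disc_poly_parallel: "conn_poly (parallel G H) q + disc_poly (parallel G H) q =
      (conn_poly G q + disc_poly G q) * (conn_poly H q + disc_poly H q)"
proof -
  have *: "disc_term (parallel G H) q (F\<^sub>1 <+> F\<^sub>2) = disc_term G q F\<^sub>1 * disc_term H q F\<^sub>2"
    "conn_term (parallel G H) q (F\<^sub>1 <+> F\<^sub>2) + disc_term (parallel G H) q (F\<^sub>1 <+> F\<^sub>2) =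
      (conn_term G q F\<^sub>1 + disc_term G q F\<^sub>1) * (conn_term H q F\<^sub>2 + disc_term H q F\<^sub>2)"
    if "F\<^sub>1 \<subseteq> edges G" "F\<^sub>2 \<subseteq> edges H" for F\<^sub>1 F\<^sub>2
  proof -
    define k l where "k = num_components G F\<^sub>1" and "l = num_components H F\<^sub>2"
    have kl: "1 \<le> k" "\<not> connects_terminals G F\<^sub>1 \<Longrightarrow> 2 \<le> k"
      "1 \<le> l" "\<not> connects_terminals H F\<^sub>2 \<Longrightarrow> 2 \<le> l"
      unfolding k_def l_def using num_components_ge G H by blast+
    note simps = conn_term_def disc_term_def connects_terminals_parallel[OF G that(1) H that(2)]
      num_components_parallel[OF G that(1) H that(2)] card_Plus_subset[OF G H that]
      k_def[symmetric] l_def[symmetric] power_add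
    obtain k' where k': "k = Suc k'" using kl by (cases k) auto
    obtain l' where l': "l = Suc l'" using kl by (cases l) auto
    show "disc_term (parallel G H) q (F\<^sub>1 <+> F\<^sub>2) = disc_term G q F\<^sub>1 * disc_term H q F\<^sub>2"
      using kl by (cases k'; cases l') (auto simp: simps k' l')
    show "conn_term (parallel G H) q (F\<^sub>1 <+> F\<^sub>2) + disc_term (parallel G H) q (F\<^sub>1 <+> F\<^sub>2) =
      (conn_term G q F\<^sub>1 + disc_term G q F\<^sub>1) * (conn_term H q F\<^sub>2 + disc_term H q F\<^sub>2)"
      using kl by (cases k'; cases l') (auto simp: simps k' l')
  qed
  show "disc_poly (parallel G H) q = disc_poly G q * disc_poly H q"
    unfolding disc_poly_def edges_parallel by (rule sum_Pow_Plus_product) (rule *)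
  show "conn_poly (parallel G H) q + disc_poly (parallel G H) q =
      (conn_poly G q + disc_poly G q) * (conn_poly H q + disc_poly H q)"
    unfolding conn_poly_def disc_poly_def edges_parallel sum.distrib[symmetric]
    by (rule sum_Pow_Plus_product) (rule *)
qed

text \<open>Dually, an edge set of a series composition joins the terminals only if both parts do. The other
  identity is the familiar product formula for the chromatic polynomial of two graphs that share one
  vertex.\<close>

lemma
  assumes G: "wf_tt_graph G" and H: "wf_tt_graph H"
  shows conn_poly_series: "conn_poly (series G H) q = conn_poly G q * conn_poly H q"
    and conn_disc_poly_series: "conn_poly (series G H) q + q * disc_poly (series G H) q =
      (conn_poly G q + q * disc_poly G q) * (conn_poly H q + q * disc_poly H q)"
proof -
  have *: "conn_term (series G H) q (F\<^sub>1 <+> F\<^sub>2) = conn_term G q F\<^sub>1 * conn_term H q F\<^sub>2"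
    "conn_term (series G H) q (F\<^sub>1 <+> F\<^sub>2) + q * disc_term (series G H) q (F\<^sub>1 <+> F\<^sub>2) =
      (conn_term G q F\<^sub>1 + q * disc_term G q F\<^sub>1) * (conn_term H q F\<^sub>2 + q * disc_term H q F\<^sub>2)"
    if "F\<^sub>1 \<subseteq> edges G" "F\<^sub>2 \<subseteq> edges H" for F\<^sub>1 F\<^sub>2
  proof -
    define k l where "k = num_components G F\<^sub>1" and "l = num_components H F\<^sub>2"
    have kl: "1 \<le> k" "\<not> connects_terminals G F\<^sub>1 \<Longrightarrow> 2 \<le> k"
      "1 \<le> l" "\<not> connects_terminals H F\<^sub>2 \<Longrightarrow> 2 \<le> l"
      unfolding k_def l_def using num_components_ge G H by blast+
    note simps = conn_term_def disc_term_def connects_terminals_series[OF G that(1) H that(2)]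
      num_components_series[OF G that(1) H that(2)] card_Plus_subset[OF G H that]
      k_def[symmetric] l_def[symmetric] power_add
    obtain k' where k': "k = Suc k'" using kl by (cases k) auto
    obtain l' where l': "l = Suc l'" using kl by (cases l) auto
    show "conn_term (series G H) q (F\<^sub>1 <+> F\<^sub>2) = conn_term G q F\<^sub>1 * conn_term H q F\<^sub>2"
      by (auto simp: simps k' l')
    show "conn_term (series G H) q (F\<^sub>1 <+> F\<^sub>2) + q * disc_term (series G H) q (F\<^sub>1 <+> F\<^sub>2) =
      (conn_term G q F\<^sub>1 + q * disc_term G q F\<^sub>1) * (conn_term H q F\<^sub>2 + q * disc_term H q F\<^sub>2)"
      using kl by (cases k'; cases l') (auto simp: simps k' l')
  qed
  show "conn_poly (series G H) q = conn_poly G q * conn_poly H q"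
    unfolding conn_poly_def edges_series by (rule sum_Pow_Plus_product) (rule *)
  show "conn_poly (series G H) q + q * disc_poly (series G H) q =
      (conn_poly G q + q * disc_poly G q) * (conn_poly H q + q * disc_poly H q)"
    unfolding conn_poly_def disc_poly_def edges_series sum_distrib_left[where r = q] sum.distrib[symmetric]
    by (rule sum_Pow_Plus_product) (rule *)
qed

lemma
  assumes "tt_isomorphic G H" and G: "wf_tt_graph G"
  shows conn_poly_isomorphic: "conn_poly H q = conn_poly G q"
    and disc_poly_isomorphic: "disc_poly H q = disc_poly G q"
proof -
  obtain f g where f: "bij_betw f (verts G) (verts H)" and g: "bij_betw g (edges G) (edges H)"
    and ends: "\<And>e. e \<in> edges G \<Longrightarrow> ends H (g e) = map_uprod f (ends G e)"
    and st: "f (start_vertex G) = start_vertex H" "f (end_vertex G) = end_vertex H"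
    using assms(1) unfolding tt_isomorphic_def by blast
  have Pow: "bij_betw ((`) g) (Pow (edges G)) (Pow (edges H))"
    using g by (rule bij_betw_Pow)
  have card: "card (g ` F) = card F" if "F \<subseteq> edges G" for F
    using g that by (auto simp: bij_betw_def intro: card_image inj_on_subset)
  have *: "conn_term H q (g ` F) = conn_term G q F" "disc_term H q (g ` F) = disc_term G q F"
    if "F \<subseteq> edges G" for F
    using connects_terminals_isomorphic[OF G f ends st that]
      num_components_isomorphic[OF G f ends st that] card[OF that]
    by (simp_all add: conn_term_def disc_term_def)
  show "conn_poly H q = conn_poly G q" "disc_poly H q = disc_poly G q"
    unfolding conn_poly_def disc_poly_def sum.reindex_bij_betw[OF Pow, symmetric]
    by (intro sum.cong refl *; simp)+
qed

lemma
  shows conn_poly_K2: "conn_poly K2 q = - 1" and disc_poly_K2: "disc_poly K2 q = 1"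
proof -
  have e: "adjacent_via K2 {} = {}" "adjacent_via K2 {()} = {(False, True), (True, False)}"
    by (auto simp: adjacent_via_def K2_def)
  have all: "{(False, True), (True, False)}\<^sup>* = UNIV"
    by (auto simp: set_eq_iff) (metis (full_types) insert_iff r_into_rtrancl rtrancl.rtrancl_refl)
  have n: "num_components K2 {} = 2"
  proof -
    have "verts K2 // Id = {{False}, {True}}" by (auto simp: quotient_def K2_def)
    then show ?thesis by (simp add: num_components_def e)
  qed
  have n': "num_components K2 {()} = 1"
  proof -
    have "verts K2 // UNIV = {UNIV}" by (auto simp: quotient_def K2_def)
    then show ?thesis by (simp add: num_components_def e all)
  qed
  have c: "\<not> connects_terminals K2 {}" "connects_terminals K2 {()}"
    unfolding connects_terminals_def e all by (auto simp: K2_def)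
  have "Pow (edges K2) = {{}, {()}}" by (auto simp: K2_def)
  then show "conn_poly K2 q = - 1" "disc_poly K2 q = 1"
    by (simp_all add: conn_poly_def disc_poly_def conn_term_def disc_term_def n n' c)
qed

section \<open>Realising powers by series-parallel graphs\<close>

text \<open>Compositions live on new vertex and edge types; finiteness brings them back to \<open>nat\<close>.\<close>

lemma tt_isomorphic_nat_copy:
  assumes "wf_tt_graph G"
  obtains H :: "(nat, nat) tt_graph" where "tt_isomorphic G H"
proof -
  obtain f where f: "inj_on f (verts G)" "f ` verts G \<subseteq> (UNIV :: nat set)"
    using assms by (metis finite_imp_inj_to_nat_seg subset_UNIV wf_tt_graph_def finite_multigraph_def)
  obtain g where g: "inj_on g (edges G)" "g ` edges G \<subseteq> (UNIV :: nat set)"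
    using assms by (metis finite_imp_inj_to_nat_seg subset_UNIV wf_tt_graph_def finite_multigraph_def)
  define H :: "(nat, nat) tt_graph" where
    "H = \<lparr>verts = f ` verts G, edges = g ` edges G,
      ends = (\<lambda>e. map_uprod f (ends G (inv_into (edges G) g e))),
      start_vertex = f (start_vertex G), end_vertex = f (end_vertex G)\<rparr>"
  have "tt_isomorphic G H"
    unfolding tt_isomorphic_def
    by (rule exI[of _ f], rule exI[of _ g]) (use f g in \<open>simp add: H_def bij_betw_def\<close>)
  then show ?thesis by (rule that)
qed

lemma series_parallel_K2:
  obtains G :: "(nat, nat) tt_graph" where "series_parallel G"
    "\<And>q :: 'a::comm_ring_1. conn_poly G q = - 1" "\<And>q :: 'a. disc_poly G q = 1"
proof -
  obtain G :: "(nat, nat) tt_graph" where G: "tt_isomorphic K2 G"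
    using tt_isomorphic_nat_copy K2_wf by blast
  then have "series_parallel G" by (rule series_parallel.edge)
  then show ?thesis
    using G that by (simp add: conn_poly_isomorphic[OF G K2_wf] disc_poly_isomorphic[OF G K2_wf] conn_poly_K2 disc_poly_K2)
qed

lemma series_parallel_parallel_copy:
  fixes G H :: "(nat, nat) tt_graph"
  assumes G: "series_parallel G" and H: "series_parallel H"
  obtains K :: "(nat, nat) tt_graph" where "series_parallel K"
    "\<And>q :: 'a::comm_ring_1. disc_poly K q = disc_poly G q * disc_poly H q"
    "\<And>q :: 'a. conn_poly K q + disc_poly K q = (conn_poly G q + disc_poly G q) * (conn_poly H q + disc_poly H q)"
proof -
  have wf: "wf_tt_graph G" "wf_tt_graph H" using G H by (auto intro: series_parallel_wf)
  then have P: "wf_tt_graph (parallel G H)" by (rule parallel_wf)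
  then obtain K :: "(nat, nat) tt_graph" where K: "tt_isomorphic (parallel G H) K"
    by (rule tt_isomorphic_nat_copy)
  show ?thesis
    using series_parallel.parallel[OF G H K] that
    by (simp add: conn_poly_isomorphic[OF K P] disc_poly_isomorphic[OF K P]
        disc_poly_parallel[OF wf] conn_disc_poly_parallel[OF wf, unfolded disc_poly_parallel[OF wf]])
qed

lemma series_parallel_series_copy:
  fixes G H :: "(nat, nat) tt_graph"
  assumes G: "series_parallel G" and H: "series_parallel H"
  obtains K :: "(nat, nat) tt_graph" where "series_parallel K"
    "\<And>q :: 'a::comm_ring_1. conn_poly K q = conn_poly G q * conn_poly H q"
    "\<And>q :: 'a. conn_poly K q + q * disc_poly K q = (conn_poly G q + q * disc_poly G q) * (conn_poly H q + q * disc_poly H q)"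
proof -
  have wf: "wf_tt_graph G" "wf_tt_graph H" using G H by (auto intro: series_parallel_wf)
  then have P: "wf_tt_graph (series G H)" by (rule series_wf)
  then obtain K :: "(nat, nat) tt_graph" where K: "tt_isomorphic (series G H) K"
    by (rule tt_isomorphic_nat_copy)
  show ?thesis
    using series_parallel.series[OF G H K] that
    by (simp add: conn_poly_isomorphic[OF K P] disc_poly_isomorphic[OF K P]
        conn_poly_series[OF wf] conn_disc_poly_series[OF wf, unfolded conn_poly_series[OF wf]])
qed

lemma parallel_power:
  fixes G :: "(nat, nat) tt_graph"
  assumes G: "series_parallel G"
  shows "\<exists>H :: (nat, nat) tt_graph. series_parallel H \<and> (\<forall>q :: 'a::comm_ring_1.
    disc_poly H q = disc_poly G q ^ Suc k \<and>
    conn_poly H q + disc_poly H q = (conn_poly G q + disc_poly G q) ^ Suc k)"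
proof (induction k)
  case 0
  show ?case using G by auto
next
  case (Suc k)
  then obtain H :: "(nat, nat) tt_graph" where H: "series_parallel H"
    "\<And>q :: 'a. disc_poly H q = disc_poly G q ^ Suc k"
    "\<And>q :: 'a. conn_poly H q + disc_poly H q = (conn_poly G q + disc_poly G q) ^ Suc k"
    by blast
  obtain K :: "(nat, nat) tt_graph" where K: "series_parallel K"
    "\<And>q :: 'a::comm_ring_1. disc_poly K q = disc_poly G q * disc_poly H q"
    "\<And>q :: 'a. conn_poly K q + disc_poly K q = (conn_poly G q + disc_poly G q) * (conn_poly H q + disc_poly H q)"
    using series_parallel_parallel_copy[OF G H(1), where 'a = 'a] by blast
  have "disc_poly K q = disc_poly G q ^ Suc (Suc k) \<and>
    conn_poly K q + disc_poly K q = (conn_poly G q + disc_poly G q) ^ Suc (Suc k)" for q :: 'a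
    unfolding K(3) H(3) unfolding K(2) H(2) by simp
  with K(1) show ?case by blast
qed

lemma series_power:
  fixes G :: "(nat, nat) tt_graph"
  assumes G: "series_parallel G"
  shows "\<exists>H :: (nat, nat) tt_graph. series_parallel H \<and> (\<forall>q :: 'a::comm_ring_1.
    conn_poly H q = conn_poly G q ^ Suc k \<and>
    conn_poly H q + q * disc_poly H q = (conn_poly G q + q * disc_poly G q) ^ Suc k)"
proof (induction k)
  case 0
  show ?case using G by auto
next
  case (Suc k)
  then obtain H :: "(nat, nat) tt_graph" where H: "series_parallel H"
    "\<And>q :: 'a. conn_poly H q = conn_poly G q ^ Suc k"
    "\<And>q :: 'a. conn_poly H q + q * disc_poly H q = (conn_poly G q + q * disc_poly G q) ^ Suc k"
    by blast
  obtain K :: "(nat, nat) tt_graph" where K: "series_parallel K"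
    "\<And>q :: 'a::comm_ring_1. conn_poly K q = conn_poly G q * conn_poly H q"
    "\<And>q :: 'a. conn_poly K q + q * disc_poly K q = (conn_poly G q + q * disc_poly G q) * (conn_poly H q + q * disc_poly H q)"
    using series_parallel_series_copy[OF G H(1), where 'a = 'a] by blast
  have "conn_poly K q = conn_poly G q ^ Suc (Suc k) \<and>
    conn_poly K q + q * disc_poly K q = (conn_poly G q + q * disc_poly G q) ^ Suc (Suc k)" for q :: 'a
    unfolding K(3) H(3) unfolding K(2) H(2) by simp
  with K(1) show ?case by blast
qed

lemma series_parallel_path2:
  obtains G :: "(nat, nat) tt_graph" where "series_parallel G"
    "\<And>q :: 'a::idom. conn_poly G q = 1" "\<And>q :: 'a. q \<noteq> 0 \<Longrightarrow> disc_poly G q = q - 2"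
proof -
  obtain E :: "(nat, nat) tt_graph" where E: "series_parallel E"
    "\<And>q :: 'a. conn_poly E q = - 1" "\<And>q :: 'a. disc_poly E q = 1"
    using series_parallel_K2 by blast
  obtain G :: "(nat, nat) tt_graph" where G: "series_parallel G"
    "\<And>q :: 'a. conn_poly G q = conn_poly E q * conn_poly E q"
    "\<And>q :: 'a. conn_poly G q + q * disc_poly G q = (conn_poly E q + q * disc_poly E q) * (conn_poly E q + q * disc_poly E q)"
    using series_parallel_series_copy[OF E(1) E(1)] by blast
  have "disc_poly G q = q - 2" if "q \<noteq> 0" for q :: 'a
  proof -
    have "q * disc_poly G q = q * (q - 2)"
      using G(3)[of q] by (simp add: G(2) E algebra_simps)
    with that show ?thesis by simp
  qed
  then show ?thesis using that G by (simp add: E)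
qed

section \<open>Powers of holomorphic functions\<close>

text \<open>This is the Montel argument of the proof. If \<open>\<bar>a\<bar>\<close> and \<open>\<bar>b\<bar>\<close> cross, then \<open>h = a / b\<close> has modulus one
  at some point \<open>w\<close> without being constant, so the powers of \<open>h\<close> are bounded at \<open>w\<close> but on no
  neighbourhood of it. The functions \<open>h ^ Suc k / p\<close> then cannot all omit the values \<open>0\<close> and \<open>1\<close>.
  The statement avoids division so that zeros of \<open>b\<close> elsewhere in \<open>U\<close> do no harm.\<close>

lemma power_coincidence_if_moduli_cross:
  assumes hol: "a holomorphic_on U" "b holomorphic_on U" "p holomorphic_on U"
    and U: "open U" "connected U"
    and p0: "\<And>z. z \<in> U \<Longrightarrow> p z \<noteq> 0"
    and z1: "z\<^sub>1 \<in> U" "cmod (b z\<^sub>1) < cmod (a z\<^sub>1)"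
    and z2: "z\<^sub>2 \<in> U" "cmod (a z\<^sub>2) < cmod (b z\<^sub>2)"
  shows "\<exists>z\<in>U. \<exists>k. a z ^ Suc k = p z * b z ^ Suc k"
proof (rule ccontr)
  assume "\<not> ?thesis"
  then have omit: "a z ^ Suc k \<noteq> p z * b z ^ Suc k" if "z \<in> U" for k z using that by blast
  define u where "u z = cmod (a z) - cmod (b z)" for z
  have "continuous_on U u"
    unfolding u_def by (intro continuous_intros holomorphic_on_imp_continuous_on hol)
  then have conn: "connected (u ` U)" using U(2) by (rule connected_continuous_image)
  have "0 \<in> u ` U"
    by (rule connectedD_interval[OF conn imageI[OF z2(1)] imageI[OF z1(1)]]) (use z1 z2 in \<open>auto simp: u_def\<close>)
  then obtain w where w: "w \<in> U" "cmod (a w) = cmod (b w)" by (auto simp: u_def)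
  (* if both vanished at w, then w itself would be a coincidence with exponent one *)
  have "a w \<noteq> 0" "b w \<noteq> 0" using omit[OF w(1), of 0] w(2) by auto
  have "open (U \<inter> a -` (- {0}))" "open (U \<inter> b -` (- {0}))"
    using U(1) hol by (auto intro!: continuous_open_preimage holomorphic_on_imp_continuous_on)
  then have "open ((U \<inter> a -` (- {0})) \<inter> (U \<inter> b -` (- {0})))" by (rule open_Int)
  moreover have "w \<in> (U \<inter> a -` (- {0})) \<inter> (U \<inter> b -` (- {0}))"
    using w \<open>a w \<noteq> 0\<close> \<open>b w \<noteq> 0\<close> by auto
  ultimately obtain r where r: "0 < r" "ball w r \<subseteq> (U \<inter> a -` (- {0})) \<inter> (U \<inter> b -` (- {0}))"
    by (meson open_contains_ball)
  then have B: "z \<in> U" "a z \<noteq> 0" "b z \<noteq> 0" if "z \<in> ball w r" for z using that by auto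
  have BU: "ball w r \<subseteq> U" using B(1) by blast
  define h where "h z = a z / b z" for z
  have h_hol: "h holomorphic_on ball w r"
    unfolding h_def using B by (intro holomorphic_intros hol[THEN holomorphic_on_subset] BU) auto
  define X where "X = range (\<lambda>k z. h z ^ Suc k / p z)"
  (* X omits 0 and 1 and is bounded at w, where cmod (h w) = 1: Picard-Schottky bounds it near w *)
  obtain C Z where C: "0 < C" "open Z" "w \<in> Z" "Z \<subseteq> ball w r"
    "\<And>f z. f \<in> X \<Longrightarrow> z \<in> Z \<Longrightarrow> cmod (f z) \<le> C"
  proof (rule GPicard1[of "ball w r" w "1 / cmod (p w)" X X])
    show "f holomorphic_on ball w r" if "f \<in> X" for f
    proof -
      obtain k where k: "f = (\<lambda>z. h z ^ Suc k / p z)" using \<open>f \<in> X\<close> by (auto simp: X_def)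
      show ?thesis unfolding k using p0 B(1)
        by (intro holomorphic_on_divide holomorphic_on_power h_hol hol(3)[THEN holomorphic_on_subset] BU) blast
    qed
    show "f z \<noteq> 0 \<and> f z \<noteq> 1" if "f \<in> X" "z \<in> ball w r" for f z
    proof -
      obtain k where k: "f = (\<lambda>z. h z ^ Suc k / p z)" using \<open>f \<in> X\<close> by (auto simp: X_def)
      have "f z \<noteq> 0" using B[OF that(2)] p0[of z] by (simp add: k h_def)
      moreover have "f z \<noteq> 1"
      proof
        assume "f z = 1"
        then have "h z ^ Suc k = p z" using p0[OF B(1)[OF that(2)]] by (simp add: k)
        then have "a z ^ Suc k = p z * b z ^ Suc k"
          using B(3)[OF that(2)] by (simp add: h_def power_divide field_simps)
        then show False using omit[OF B(1)[OF that(2)]] by blast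
      qed
      ultimately show ?thesis by simp
    qed
    show "cmod (f w) \<le> 1 / cmod (p w)" if "f \<in> X" for f
      using that w(2) \<open>b w \<noteq> 0\<close> by (auto simp: X_def h_def norm_divide norm_power norm_mult)
  qed (use r(1) p0[OF w(1)] in auto)
  have "cmod (h z) \<le> cmod (h w)" if "z \<in> Z" for z
  proof -
    have "cmod (h z) ^ Suc k \<le> C * cmod (p z)" for k
    proof -
      have "cmod (h z ^ Suc k / p z) \<le> C" by (rule C(5)[OF _ that]) (auto simp: X_def)
      moreover have "0 < cmod (p z)" using that C(4) p0 B(1) by auto
      ultimately show ?thesis by (simp add: norm_divide norm_power norm_mult field_simps)
    qed
    note bound = this
    have "cmod (h z) \<le> 1"
    proof (rule ccontr)
      assume "\<not> cmod (h z) \<le> 1"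
      then have gt: "1 < cmod (h z)" by simp
      then obtain k where "C * cmod (p z) < cmod (h z) ^ k" using real_arch_pow by blast
      also have "\<dots> \<le> cmod (h z) ^ Suc k" using gt by (intro power_increasing) auto
      finally show False using bound[of k] by simp
    qed
    then show ?thesis using w(2) \<open>b w \<noteq> 0\<close> by (simp add: h_def norm_divide)
  qed
  (* so cmod h has a local maximum at w; a constant h would exclude the crossing *)
  with maximum_modulus_principle[of h "ball w r" Z w] h_hol C(2-4)
  have "h constant_on ball w r" by auto
  then obtain c where c: "\<And>z. z \<in> ball w r \<Longrightarrow> h z = c" by (auto simp: constant_on_def)
  have "a z = c * b z" if "z \<in> U" for z
  proof (rule analytic_continuation_open[of "ball w r" U a "\<lambda>z. c * b z"])
    show "a z = c * b z" if "z \<in> ball w r" for z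
      using c[OF that] B[OF that] by (auto simp: h_def)
  qed (use U BU hol r(1) that in \<open>auto intro!: holomorphic_intros\<close>)
  moreover have "cmod c = 1"
    using c[of w] r(1) w(2) \<open>b w \<noteq> 0\<close> by (auto simp: h_def norm_divide)
  ultimately show False using z1 by (simp add: norm_mult)
qed

text \<open>Rotating \<open>c\<^sub>0\<close> by an angle of at most \<open>pi / n\<close> turns its \<open>n\<close>-th power by any prescribed angle.\<close>

lemma powers_cover_circle_near:
  fixes c\<^sub>0 :: complex
  assumes "0 < \<delta>" and c0: "c\<^sub>0 \<noteq> 0"
  obtains N where "\<And>n u. N \<le> n \<Longrightarrow> cmod u = 1 \<Longrightarrow>
    \<exists>c\<in>ball c\<^sub>0 \<delta>. cmod c = cmod c\<^sub>0 \<and> c ^ n = of_real (cmod c\<^sub>0 ^ n) * u"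
proof -
  obtain N where N: "cmod c\<^sub>0 * pi / \<delta> < real N" using reals_Archimedean2 by blast
  show thesis
  proof (rule that[of "Suc N"])
    fix n and u :: complex assume n: "Suc N \<le> n" and u: "cmod u = 1"
    define v where "v = u * (of_real (cmod c\<^sub>0) / c\<^sub>0) ^ n"
    define t where "t = Arg v"
    define c where "c = c\<^sub>0 * exp (\<i> * of_real (t / n))"
    have "cmod v = 1" using u c0 by (simp add: v_def norm_mult norm_power norm_divide)
    then have v: "exp (\<i> * of_real t) = v"
      unfolding t_def using Arg_eq[of v] by (metis mult_1 norm_zero of_real_1 zero_neq_one)
    have t: "\<bar>t\<bar> \<le> pi" using Arg_bounded[of v] by (auto simp: t_def)
    have "cmod (c - c\<^sub>0) = cmod c\<^sub>0 * cmod (exp (\<i> * of_real (t / n)) - 1)"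
      unfolding c_def norm_mult[symmetric] by (simp add: algebra_simps)
    also have "\<dots> = cmod c\<^sub>0 * (2 * \<bar>sin (t / n / 2)\<bar>)" by (simp only: dist_exp_i_1)
    also have "\<dots> \<le> cmod c\<^sub>0 * \<bar>t / n\<bar>"
      using abs_sin_x_le_abs_x[of "t / n / 2"] by (intro mult_left_mono) auto
    also have "\<dots> \<le> cmod c\<^sub>0 * (pi / n)"
      using t by (intro mult_left_mono) (auto simp: divide_right_mono)
    also have "\<dots> < \<delta>"
    proof -
      have "cmod c\<^sub>0 * pi / \<delta> < real n" using N n by linarith
      then show ?thesis using assms(1) n by (simp add: field_simps)
    qed
    finally have "c \<in> ball c\<^sub>0 \<delta>" by (simp add: dist_norm norm_minus_commute)
    moreover have "cmod c = cmod c\<^sub>0" by (simp add: c_def norm_mult)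
    moreover have "c ^ n = of_real (cmod c\<^sub>0 ^ n) * u"
    proof -
      have "exp (\<i> * of_real (t / n)) ^ n = exp (\<i> * of_real t)"
        using n by (simp flip: exp_of_nat_mult)
      then have "c ^ n = c\<^sub>0 ^ n * v" by (simp add: c_def power_mult_distrib v)
      then show ?thesis using c0 by (simp add: v_def power_divide)
    qed
    ultimately show "\<exists>c\<in>ball c\<^sub>0 \<delta>. cmod c = cmod c\<^sub>0 \<and> c ^ n = of_real (cmod c\<^sub>0 ^ n) * u" by blast
  qed
qed

text \<open>Whether \<open>g\<close> is closer to \<open>1\<close> or to \<open>1 - q\<close> is decided by a linear function of \<open>g\<close>, whose gradient
  points in the direction of \<open>q\<close>.\<close>

lemma cmod_shift_difference:
  "(cmod (g - 1 + q))\<^sup>2 - (cmod (g - 1))\<^sup>2 = 2 * Re (g * cnj q) - 2 * Re q + (cmod q)\<^sup>2"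
  unfolding cmod_power2 by (simp add: power2_eq_square algebra_simps)

text \<open>The conclusion compares the distances from \<open>c q ^ Suc n\<close> to \<open>1\<close> and to \<open>1 - q\<close>. Near \<open>w\<close> the
  perpendicular bisector of these two points is nearly fixed, while high powers of \<open>c\<close> have large
  modulus and, as \<open>c\<close> is open, arbitrary argument: choosing the directions \<open>w\<close> and \<open>- w\<close> puts the
  power far out on either side of the bisector.\<close>

lemma powers_cross_bisector:
  assumes c: "c holomorphic_on V" and V: "open V" "connected V" and w: "w \<in> V" "w \<noteq> 0"
    and big: "1 < cmod (c w)" and nonconst: "\<not> c constant_on V"
  obtains n q\<^sub>1 q\<^sub>2 where "q\<^sub>1 \<in> V" "1 < cmod (c q\<^sub>1)" "cmod (c q\<^sub>1 ^ Suc n - 1) < cmod (c q\<^sub>1 ^ Suc n - 1 + q\<^sub>1)"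
    and "q\<^sub>2 \<in> V" "cmod (c q\<^sub>2 ^ Suc n - 1 + q\<^sub>2) < cmod (c q\<^sub>2 ^ Suc n - 1)"
proof -
  (* within this ball q stays close enough to w in direction and size to treat the bisector as fixed *)
  define W where "W = V \<inter> ball w (cmod w / 2)"
  have W: "open W" "W \<subseteq> V" "w \<in> W" using V w by (auto simp: W_def)
  have "open (c ` W)" by (rule open_mapping_thm[OF c V W(1,2) nonconst])
  then obtain \<delta> where \<delta>: "0 < \<delta>" "ball (c w) \<delta> \<subseteq> c ` W"
    using W(3) by (meson imageI open_contains_ball)
  have "c w \<noteq> 0" using big by auto
  obtain N where N: "\<And>n u. N \<le> n \<Longrightarrow> cmod u = 1 \<Longrightarrow>
    \<exists>c'\<in>ball (c w) \<delta>. cmod c' = cmod (c w) \<and> c' ^ n = of_real (cmod (c w) ^ n) * u"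
    using powers_cover_circle_near[OF \<delta>(1) \<open>c w \<noteq> 0\<close>] by blast
  (* for such q, 2 * cmod q + (cmod q)^2 is at most cmod w times this bound, so it is outweighed *)
  obtain M where M: "3 + 9 / 4 * cmod w < cmod (c w) ^ M" using real_arch_pow[OF big] by blast
  define n where "n = N + M"
  define \<rho> where "\<rho> = cmod (c w) ^ Suc n"
  have \<rho>: "3 + 9 / 4 * cmod w < \<rho>"
    using M power_increasing[of M "Suc n" "cmod (c w)"] big by (simp add: \<rho>_def n_def)
  have point: "\<exists>q\<in>V. cmod (c q) = cmod (c w) \<and> c q ^ Suc n = of_real \<rho> * u \<and> cmod (q - w) < cmod w / 2"
    if u: "cmod u = 1" for u
  proof -
    obtain c' where c': "c' \<in> ball (c w) \<delta>" "cmod c' = cmod (c w)" "c' ^ Suc n = of_real \<rho> * u"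
      using N[of "Suc n" u] u by (auto simp: n_def \<rho>_def)
    then obtain q where "q \<in> W" "c q = c'" using \<delta>(2) by blast
    with c' show ?thesis by (auto simp: W_def dist_norm norm_minus_commute)
  qed
  have w0: "0 < cmod w" using w by simp
  have Re_of_real_mult: "Re (of_real x * z) = x * Re z" for x z by simp
  have half: "cmod w / 2 \<le> Re (sgn w * cnj q)" and size: "cmod q \<le> 3 / 2 * cmod w"
    if "cmod (q - w) < cmod w / 2" for q
  proof -
    have "sgn w * cnj w = of_real (cmod w)"
      using w0 by (simp add: sgn_eq complex_norm_square[symmetric] power2_eq_square field_simps)
    then have "Re (sgn w * cnj q) = cmod w + Re (sgn w * cnj (q - w))"
      by (simp add: algebra_simps)
    moreover have "\<bar>Re (sgn w * cnj (q - w))\<bar> \<le> cmod (sgn w * cnj (q - w))" by (rule abs_Re_le_cmod)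
    moreover have "cmod (sgn w * cnj (q - w)) = cmod (q - w)"
      using w by (simp add: norm_mult norm_sgn del: complex_cnj_diff)
    ultimately show "cmod w / 2 \<le> Re (sgn w * cnj q)" using that by linarith
    show "cmod q \<le> 3 / 2 * cmod w"
      using norm_triangle_ineq[of "q - w" w] that by simp
  qed
  have "cmod (sgn w) = 1" "cmod (- sgn w) = 1" using w by (simp_all add: norm_sgn)
  then obtain q\<^sub>1 q\<^sub>2 where
    q1: "q\<^sub>1 \<in> V" "cmod (c q\<^sub>1) = cmod (c w)" "c q\<^sub>1 ^ Suc n = of_real \<rho> * sgn w" "cmod (q\<^sub>1 - w) < cmod w / 2" and
    q2: "q\<^sub>2 \<in> V" "c q\<^sub>2 ^ Suc n = of_real \<rho> * - sgn w" "cmod (q\<^sub>2 - w) < cmod w / 2"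
    using point by blast
  have \<rho>0: "0 \<le> \<rho>" by (simp add: \<rho>_def)
  have main: "\<rho> * cmod w \<le> 2 * (\<rho> * Re (sgn w * cnj q))" if "cmod (q - w) < cmod w / 2" for q
    using mult_left_mono[OF half[OF that] \<rho>0] by linarith
  have lower: "3 * cmod w + 9 / 4 * (cmod w)\<^sup>2 < \<rho> * cmod w"
    using mult_strict_right_mono[OF \<rho> w0] by (simp add: algebra_simps power2_eq_square)
  have "0 < (cmod (c q\<^sub>1 ^ Suc n - 1 + q\<^sub>1))\<^sup>2 - (cmod (c q\<^sub>1 ^ Suc n - 1))\<^sup>2"
  proof -
    have "Re (c q\<^sub>1 ^ Suc n * cnj q\<^sub>1) = \<rho> * Re (sgn w * cnj q\<^sub>1)"
      unfolding q1(3) mult.assoc Re_of_real_mult ..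
    moreover have "0 \<le> (cmod q\<^sub>1)\<^sup>2" "0 \<le> (cmod w)\<^sup>2" by simp_all
    ultimately show ?thesis
      unfolding cmod_shift_difference
      using main[OF q1(4)] lower size[OF q1(4)] complex_Re_le_cmod[of q\<^sub>1] by linarith
  qed
  then have "cmod (c q\<^sub>1 ^ Suc n - 1) < cmod (c q\<^sub>1 ^ Suc n - 1 + q\<^sub>1)"
    by (intro power2_less_imp_less[OF _ norm_ge_zero]) simp
  moreover have "(cmod (c q\<^sub>2 ^ Suc n - 1 + q\<^sub>2))\<^sup>2 - (cmod (c q\<^sub>2 ^ Suc n - 1))\<^sup>2 < 0"
  proof -
    have "Re (c q\<^sub>2 ^ Suc n * cnj q\<^sub>2) = - (\<rho> * Re (sgn w * cnj q\<^sub>2))"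
      unfolding q2(2) mult.assoc Re_of_real_mult mult_minus_left uminus_complex.sel(1) mult_minus_right ..
    moreover have "(cmod q\<^sub>2)\<^sup>2 \<le> (3 / 2 * cmod w)\<^sup>2" by (intro power_mono size q2) simp
    then have "(cmod q\<^sub>2)\<^sup>2 \<le> 9 / 4 * (cmod w)\<^sup>2" by (simp add: power_mult_distrib power2_eq_square)
    moreover have "- Re q\<^sub>2 \<le> cmod q\<^sub>2" using abs_Re_le_cmod[of q\<^sub>2] by linarith
    ultimately show ?thesis
      unfolding cmod_shift_difference
      using main[OF q2(3)] lower size[OF q2(3)] by linarith
  qed
  then have "cmod (c q\<^sub>2 ^ Suc n - 1 + q\<^sub>2) < cmod (c q\<^sub>2 ^ Suc n - 1)"
    by (intro power2_less_imp_less[OF _ norm_ge_zero]) simp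
  ultimately show thesis using that q1 q2 big by metis
qed

section \<open>Density of the chromatic zeros\<close>

lemma holomorphic_on_conn_poly [holomorphic_intros]: "conn_poly G holomorphic_on A"
proof -
  have "(\<lambda>q. conn_term G q F) holomorphic_on A" for F
    by (cases "connects_terminals G F") (auto simp: conn_term_def intro!: holomorphic_intros)
  then show ?thesis
    unfolding conn_poly_def[abs_def] by (intro holomorphic_intros)
qed

lemma holomorphic_on_disc_poly [holomorphic_intros]: "disc_poly G holomorphic_on A"
proof -
  have "(\<lambda>q. disc_term G q F) holomorphic_on A" for F
    by (cases "connects_terminals G F") (auto simp: disc_term_def intro!: holomorphic_intros)
  then show ?thesis
    unfolding disc_poly_def[abs_def] by (intro holomorphic_intros)
qed

lemma parallel_powers_of_paths:
  obtains G :: "(nat, nat) tt_graph" where "series_parallel G"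
    "\<And>q :: complex. q \<noteq> 0 \<Longrightarrow> disc_poly G q = (q - 2) ^ Suc n"
    "\<And>q :: complex. q \<noteq> 0 \<Longrightarrow> conn_poly G q + disc_poly G q = (q - 1) ^ Suc n"
proof -
  obtain P :: "(nat, nat) tt_graph" where P: "series_parallel P"
    "\<And>q :: complex. conn_poly P q = 1" "\<And>q :: complex. q \<noteq> 0 \<Longrightarrow> disc_poly P q = q - 2"
    using series_parallel_path2 by blast
  obtain G :: "(nat, nat) tt_graph" where G: "series_parallel G"
    "\<And>q :: complex. disc_poly G q = disc_poly P q ^ Suc n"
    "\<And>q :: complex. conn_poly G q + disc_poly G q = (conn_poly P q + disc_poly P q) ^ Suc n"
    using parallel_power[OF P(1), of n, where 'a = complex] by blast
  show thesis
  proof (rule that[OF G(1)])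
    fix q :: complex assume "q \<noteq> 0"
    show "disc_poly G q = (q - 2) ^ Suc n" by (simp only: G(2) P(3)[OF \<open>q \<noteq> 0\<close>])
    have "1 + (q - 2) = q - 1" by simp
    then show "conn_poly G q + disc_poly G q = (q - 1) ^ Suc n"
      by (simp only: G(3) P(2) P(3)[OF \<open>q \<noteq> 0\<close>])
  qed
qed

text \<open>In terms of \<open>y = (conn + disc) / disc\<close>, the graph has chromatic zero \<open>q\<close> if \<open>y = 1 - q\<close>, and parallel
  powers of \<open>G\<close> realise the powers of \<open>y\<close>.\<close>

lemma chromatic_zero_if_moduli_cross:
  fixes G :: "(nat, nat) tt_graph"
  assumes U: "open U" "connected U" "1 \<notin> U"
    and G: "series_parallel G"
    and q1: "q\<^sub>1 \<in> U" "cmod (disc_poly G q\<^sub>1) < cmod (conn_poly G q\<^sub>1 + disc_poly G q\<^sub>1)"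
    and q2: "q\<^sub>2 \<in> U" "cmod (conn_poly G q\<^sub>2 + disc_poly G q\<^sub>2) < cmod (disc_poly G q\<^sub>2)"
  shows "\<exists>q\<in>U. \<exists>H :: (nat, nat) tt_graph. series_parallel H \<and> chromatic_polynomial H q = 0"
proof -
  have "1 - q \<noteq> 0" if "q \<in> U" for q using that U(3) by auto
  then have "\<exists>q\<in>U. \<exists>k. (conn_poly G q + disc_poly G q) ^ Suc k = (1 - q) * disc_poly G q ^ Suc k"
    by (intro power_coincidence_if_moduli_cross[OF _ _ _ U(1,2) _ q1 q2] holomorphic_intros)
  then obtain q k where q: "q \<in> U"
    and eq: "(conn_poly G q + disc_poly G q) ^ Suc k = (1 - q) * disc_poly G q ^ Suc k" by blast
  obtain H :: "(nat, nat) tt_graph" where H: "series_parallel H"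
    "disc_poly H q = disc_poly G q ^ Suc k"
    "conn_poly H q + disc_poly H q = (conn_poly G q + disc_poly G q) ^ Suc k"
    using parallel_power[OF G, of k, where 'a = complex] by blast
  then have "conn_poly H q + disc_poly H q = (1 - q) * disc_poly H q" by (simp only: eq)
  then have "conn_poly H q + q * disc_poly H q = 0" by (simp add: algebra_simps)
  then have "chromatic_polynomial H q = 0"
    by (simp add: chromatic_polynomial_split[OF series_parallel_wf[OF H(1)]])
  with q H(1) show ?thesis by blast
qed

lemma path_ratio_not_constant:
  assumes "open V" "w \<in> V" "2 \<notin> V"
  shows "\<not> (\<lambda>q :: complex. (q - 1) / (q - 2)) constant_on V"
proof
  assume "(\<lambda>q :: complex. (q - 1) / (q - 2)) constant_on V"
  then obtain c where c: "\<And>q. q \<in> V \<Longrightarrow> (q - 1) / (q - 2) = c" by (auto simp: constant_on_def)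
  obtain e where e: "0 < e" "ball w e \<subseteq> V" using assms by (meson open_contains_ball)
  define v where "v = w + of_real (e / 2)"
  have "v \<in> V" using e by (intro subsetD[OF e(2)]) (simp add: v_def dist_norm)
  have "w \<noteq> 2" "v \<noteq> 2" using assms \<open>v \<in> V\<close> by auto
  moreover have "(w - 1) / (w - 2) = (v - 1) / (v - 2)" using c assms(2) \<open>v \<in> V\<close> by simp
  ultimately have "v = w" by (simp add: field_simps)
  then show False using e(1) by (simp add: v_def)
qed

text \<open>The crossing is reached by taking powers twice, once of \<open>y\<close> and once of its dual \<open>g\<close>. The path
  of length two has \<open>y = (q - 1) / (q - 2)\<close>, and \<open>\<bar>y\<bar> > 1\<close> says precisely that \<open>Re q > 3/2\<close>. For a
  suitable parallel power of it, \<open>y ^ n\<close> lies closer to \<open>1\<close> than to \<open>1 - q\<close>, which says that the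
  dual ratio \<open>g\<close> has modulus above one. Its powers, realised by series powers, cross the
  same bisector, and this says that \<open>\<bar>y\<bar>\<close> crosses one for the resulting graph.\<close>

lemma chromatic_zero_in_open_set:
  assumes U: "open U" "connected U" "U \<subseteq> {q. 3 / 2 < Re q}" and w: "w \<in> U"
  shows "\<exists>q\<in>U. \<exists>G :: (nat, nat) tt_graph. series_parallel G \<and> chromatic_polynomial G q = 0"
proof -
  (* the ratio y of the path has its pole at 2 *)
  obtain w' r where w': "0 < r" "ball w' r \<subseteq> U - {2}"
  proof -
    have "\<not> U \<subseteq> {2}"
    proof
      assume "U \<subseteq> {2}"
      then have "finite U" by (rule finite_subset) simp
      then show False using U(1) w finite_imp_not_open by blast
    qed
    then obtain w' where "w' \<in> U - {2}" by blast
    moreover have "open (U - {2})" using U(1) by (simp add: open_Diff)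
    ultimately show thesis using that by (meson open_contains_ball)
  qed
  define V where "V = ball w' r"
  define y where "y q = (q - 1) / (q - 2)" for q :: complex
  have V: "open V" "connected V" "w' \<in> V" "2 \<notin> V" "V \<subseteq> U" using w' by (auto simp: V_def)
  have y_big: "1 < cmod (y q)" if "q \<in> V" for q
  proof -
    have "(cmod (q - 2))\<^sup>2 < (cmod (q - 1))\<^sup>2"
    proof -
      have "3 / 2 < Re q" using that V(5) U(3) by auto
      then show ?thesis unfolding cmod_power2 by (simp add: power2_eq_square algebra_simps)
    qed
    then have "cmod (q - 2) < cmod (q - 1)" by (rule power2_less_imp_less) simp
    moreover have "q \<noteq> 2" using that V(4) by auto
    ultimately show ?thesis by (simp add: y_def norm_divide)
  qed
  have y_hol: "y holomorphic_on V"
    unfolding y_def using V(4) by (intro holomorphic_intros) auto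
  have nonzero: "q \<noteq> 0" if "q \<in> U" for q using that U(3) by auto
  obtain n p where p: "p \<in> V" "1 < cmod (y p)" "cmod (y p ^ Suc n - 1) < cmod (y p ^ Suc n - 1 + p)"
    using powers_cross_bisector[OF y_hol V(1-3) _ y_big] nonzero V
      path_ratio_not_constant[OF V(1,3,4), folded y_def] by (metis subsetD)
  obtain G :: "(nat, nat) tt_graph" where G: "series_parallel G"
    "\<And>q :: complex. q \<noteq> 0 \<Longrightarrow> disc_poly G q = (q - 2) ^ Suc n"
    "\<And>q :: complex. q \<noteq> 0 \<Longrightarrow> conn_poly G q + disc_poly G q = (q - 1) ^ Suc n"
    using parallel_powers_of_paths by blast
  (* in terms of y ^ Suc n =: Y, this is (Y - 1 + q) / (Y - 1) *)
  define g where "g q = (conn_poly G q + q * disc_poly G q) / conn_poly G q" for q :: complex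
  have "p \<in> U" "p \<noteq> 2" using p(1) V by auto
  have y_pow: "(p - 1) ^ Suc n = (p - 2) ^ Suc n * y p ^ Suc n"
    using \<open>p \<noteq> 2\<close> by (simp add: y_def power_divide)
  have conn_p: "conn_poly G p = (p - 2) ^ Suc n * (y p ^ Suc n - 1)"
    using G(3)[OF nonzero[OF \<open>p \<in> U\<close>]] unfolding G(2)[OF nonzero[OF \<open>p \<in> U\<close>]] y_pow
    by (simp add: algebra_simps)
  have "y p ^ Suc n \<noteq> 1"
  proof
    assume "y p ^ Suc n = 1"
    then have "cmod (y p) ^ Suc n = 1" by (metis norm_one norm_power)
    then show False using one_less_power[OF p(2), of "Suc n"] by simp
  qed
  then have conn_p0: "conn_poly G p \<noteq> 0" using \<open>p \<noteq> 2\<close> by (simp add: conn_p)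
  have "conn_poly G p + p * disc_poly G p = (p - 2) ^ Suc n * (y p ^ Suc n - 1 + p)"
    unfolding conn_p G(2)[OF nonzero[OF \<open>p \<in> U\<close>]] by (simp add: algebra_simps)
  then have g_p: "1 < cmod (g p)"
    using p(3) \<open>p \<noteq> 2\<close> \<open>y p ^ Suc n \<noteq> 1\<close> unfolding g_def conn_p by (simp add: norm_divide norm_mult norm_power)
  have "open (U \<inter> conn_poly G -` (- {0}))"
    using U(1) by (auto intro!: continuous_open_preimage holomorphic_on_imp_continuous_on holomorphic_intros)
  moreover have "p \<in> U \<inter> conn_poly G -` (- {0})" using \<open>p \<in> U\<close> conn_p0 by simp
  ultimately obtain s where s: "0 < s" "ball p s \<subseteq> U \<inter> conn_poly G -` (- {0})"
    by (meson open_contains_ball)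
  define W where "W = ball p s"
  have W: "open W" "connected W" "p \<in> W" "W \<subseteq> U" and conn_W: "\<And>q. q \<in> W \<Longrightarrow> conn_poly G q \<noteq> 0"
    using s by (auto simp: W_def)
  have g_hol: "g holomorphic_on W"
    unfolding g_def using conn_W by (intro holomorphic_intros) auto
  have g_nonconst: "\<not> g constant_on W"
  proof
    assume "g constant_on W"
    then obtain c where c: "\<And>q. q \<in> W \<Longrightarrow> g q = c" by (auto simp: constant_on_def)
    have all: "conn_poly G q + q * disc_poly G q = c * conn_poly G q" for q
    proof (rule analytic_continuation_open[of W UNIV
          "\<lambda>q. conn_poly G q + q * disc_poly G q" "\<lambda>q. c * conn_poly G q"])
      show "conn_poly G q + q * disc_poly G q = c * conn_poly G q" if "q \<in> W" for q
        using c[OF that] conn_W[OF that] by (simp add: g_def field_simps)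
    qed (use W in \<open>auto intro!: holomorphic_intros\<close>)
    (* by the identity theorem the relation reaches 2 and 3, where the two polynomials are explicit *)
    have "disc_poly G 2 = (0 :: complex)" "conn_poly G 2 = (1 :: complex)" using G(2,3)[of 2] by simp_all
    with all[of 2] have "c = 1" by simp
    with all[of 3] G(2)[of 3] show False by simp
  qed
  obtain m q\<^sub>1 q\<^sub>2 where
    q1: "q\<^sub>1 \<in> W" "cmod (g q\<^sub>1 ^ Suc m - 1) < cmod (g q\<^sub>1 ^ Suc m - 1 + q\<^sub>1)" and
    q2: "q\<^sub>2 \<in> W" "cmod (g q\<^sub>2 ^ Suc m - 1 + q\<^sub>2) < cmod (g q\<^sub>2 ^ Suc m - 1)"
    using powers_cross_bisector[OF g_hol W(1-3) nonzero[OF \<open>p \<in> U\<close>] g_p g_nonconst] by metis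
  obtain H :: "(nat, nat) tt_graph" where H: "series_parallel H"
    "\<And>q :: complex. conn_poly H q = conn_poly G q ^ Suc m"
    "\<And>q :: complex. conn_poly H q + q * disc_poly H q = (conn_poly G q + q * disc_poly G q) ^ Suc m"
    using series_power[OF G(1), of m, where 'a = complex] by blast
  have disc_H: "q * disc_poly H q = conn_poly G q ^ Suc m * (g q ^ Suc m - 1)"
    and sum_H: "q * (conn_poly H q + disc_poly H q) = conn_poly G q ^ Suc m * (g q ^ Suc m - 1 + q)"
    if "q \<in> W" for q
  proof -
    have "conn_poly G q + q * disc_poly G q = conn_poly G q * g q"
      using conn_W[OF that] by (simp add: g_def)
    then have *: "conn_poly G q ^ Suc m + q * disc_poly H q = conn_poly G q ^ Suc m * g q ^ Suc m"
      using H(3)[of q] unfolding H(2) by (simp only: power_mult_distrib)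
    then show "q * disc_poly H q = conn_poly G q ^ Suc m * (g q ^ Suc m - 1)"
      by (simp add: right_diff_distrib del: power_Suc) (metis add_diff_cancel_left')
    then show "q * (conn_poly H q + disc_poly H q) = conn_poly G q ^ Suc m * (g q ^ Suc m - 1 + q)"
      unfolding distrib_left H(2) by (simp del: power_Suc)
  qed
  have scale: "cmod (disc_poly H q) = cmod (conn_poly G q ^ Suc m / q) * cmod (g q ^ Suc m - 1)"
    "cmod (conn_poly H q + disc_poly H q) = cmod (conn_poly G q ^ Suc m / q) * cmod (g q ^ Suc m - 1 + q)"
    and pos: "0 < cmod (conn_poly G q ^ Suc m / q)"
    if "q \<in> W" for q
  proof -
    have "q \<noteq> 0" using that W(4) nonzero by blast
    then show "0 < cmod (conn_poly G q ^ Suc m / q)" using conn_W[OF that] by simp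
    have "disc_poly H q = conn_poly G q ^ Suc m / q * (g q ^ Suc m - 1)"
      using disc_H[OF that] \<open>q \<noteq> 0\<close> by (simp add: eq_divide_eq mult.commute del: power_Suc)
    then show "cmod (disc_poly H q) = cmod (conn_poly G q ^ Suc m / q) * cmod (g q ^ Suc m - 1)"
      by (simp only: norm_mult)
    have "conn_poly H q + disc_poly H q = conn_poly G q ^ Suc m / q * (g q ^ Suc m - 1 + q)"
      using sum_H[OF that] \<open>q \<noteq> 0\<close> by (simp add: eq_divide_eq mult.commute del: power_Suc)
    then show "cmod (conn_poly H q + disc_poly H q) = cmod (conn_poly G q ^ Suc m / q) * cmod (g q ^ Suc m - 1 + q)"
      by (simp only: norm_mult)
  qed
  have "1 \<notin> U" using U(3) by auto
  show ?thesis
  proof (rule chromatic_zero_if_moduli_cross[OF U(1,2) \<open>1 \<notin> U\<close> H(1)])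
    show "q\<^sub>1 \<in> U" "q\<^sub>2 \<in> U" using q1(1) q2(1) W(4) by auto
    show "cmod (disc_poly H q\<^sub>1) < cmod (conn_poly H q\<^sub>1 + disc_poly H q\<^sub>1)"
      unfolding scale[OF q1(1)] by (rule mult_strict_left_mono[OF q1(2) pos[OF q1(1)]])
    show "cmod (conn_poly H q\<^sub>2 + disc_poly H q\<^sub>2) < cmod (disc_poly H q\<^sub>2)"
      unfolding scale[OF q2(1)] by (rule mult_strict_left_mono[OF q2(2) pos[OF q2(1)]])
  qed
qed

theorem theorem3:
  shows "{q :: complex. Re q > 3/2} \<subseteq>
    closure {q :: complex. \<exists>G :: (nat, nat) tt_graph.
      series_parallel G \<and> chromatic_polynomial G q = 0}"
proof
  fix q :: complex assume q: "q \<in> {q. Re q > 3/2}"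
  show "q \<in> closure {q. \<exists>G :: (nat, nat) tt_graph. series_parallel G \<and> chromatic_polynomial G q = 0}"
    unfolding closure_approachable
  proof (intro allI impI)
    fix e :: real assume "0 < e"
    define U where "U = {q. 3/2 < Re q} \<inter> ball q e"
    have "open U" unfolding U_def by (intro open_Int open_halfspace_Re_gt open_ball)
    moreover have "connected U" unfolding U_def
      by (intro convex_connected convex_Int convex_halfspace_Re_gt convex_ball)
    moreover have "U \<subseteq> {q. 3/2 < Re q}" "q \<in> U" using q \<open>0 < e\<close> by (auto simp: U_def)
    ultimately obtain z and G :: "(nat, nat) tt_graph" where
      "z \<in> U" "series_parallel G" "chromatic_polynomial G z = 0"
      using chromatic_zero_in_open_set by blast
    then show "\<exists>z\<in>{q. \<exists>G :: (nat, nat) tt_graph. series_parallel G \<and> chromatic_polynomial G q = 0}. dist z q < e"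
      by (auto simp: U_def dist_commute)
  qed
qed

end
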